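(* Let $G$ be a finite group of order $N$ and let $X$ be a $G$-$\mathcal{AS}$-set. For $k\in\mathbb{N}$ denote $X_{(k)}:=\pi_k(X\times V_N(\mathbb{R}^k))$, the geometric quotient of $X\times V_N(\mathbb{R}^k)$ by $G$. The inductive system of inclusions $X_{(k)}\to X_{(k+1)}$ induces a projective system in singular cohomology $H^*(X_{(k+1)})\to H^*(X_{(k)})$ and an isomorphism $$H^*_G(X)\to\varprojlim_{k\in\mathbb{N}}H^*(X_{(k)}).$$
   Context: $H^*(\,\cdot\,)$ denotes singular cohomology with coefficients in $\mathbb{Z}_2:=\mathbb{Z}/2\mathbb{Z}$. A semialgebraic set $A\subset\mathbb{P}^d(\mathbb{R})$ is arc-symmetric if for every real analytic arc $\gamma:(-1,1)\to\mathbb{P}^d(\mathbb{R})$, $\gamma((-1,0))\subset A$ implies $\gamma((-1,1))\subset A$; an $\mathcal{AS}$-set is a Boolean combination of arc-symmetric sets. A $G$-$\mathcal{AS}$-set is an $\mathcal{AS}$-set $X\subset\mathbb{P}^d(\mathbb{R})$ with an action of $G$ by biregular isomorphisms on its Zariski closure in $\mathbb{P}^d(\mathbb{R})$ which globally stabilizes $X$. Up to equivariant biregular isomorphism, $X$ is realized as an $\mathcal{AS}$-set $X\subset\mathbb{R}^d$ with compact Zariski closure in $\mathbb{R}^d$, the action being induced by a linear action of $G$ on $\mathbb{R}^d$ by permutations of coordinates. For $k\in\mathbb{N}$, $V_N(\mathbb{R}^k)$ is the Stiefel manifold of $k\times N$ real matrices $A$ with ${}^tAA=I_N$, and $V_N(\mathbb{R}^\infty)=\varinjlim_kV_N(\mathbb{R}^k)$,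 which is contractible. Embed $G$ in $O_N(\mathbb{R})$ by permutation matrices; $G$ acts freely on $V_N(\mathbb{R}^k)$, $k\in\mathbb{N}\cup\{\infty\}$, by $g\cdot A=Ag^{-1}$ (for finite $k$, restriction of a linear action on $\mathbb{R}^{Nk}$). Let $G$ act diagonally on $\mathbb{R}^d\times\mathbb{R}^{Nk}$, let $p_1,\dots,p_m$ generate the $\mathbb{R}$-algebra of $G$-invariant polynomials on it and $\pi_k=(p_1,\dots,p_m)$, with values in $\mathbb{R}^m$ ($m$ depends on $k$). The inclusion $\mathbb{R}^k\subset\mathbb{R}^{k+1}$ (last coordinate zero) induces closed inclusions $X_{(k)}\to X_{(k+1)}$, $\pi_k(x,A)\mapsto\pi_{k+1}(x,A)$ (generators for $k+1$ being those for $k$ together with polynomials vanishing when the new coordinates vanish). $H^*_G(X):=H^*((X\times E_G)/G)$, with $E_G$ a contractible space with a free $G$-action; here $E_G=V_N(\mathbb{R}^\infty)$. The maps $X_{(k)}\to(X\times V_N(\mathbb{R}^\infty))/G$, $\pi_k(x,A)\mapsto[(x,A)]$, identify $\varinjlim_kX_{(k)}$ with $(X\times V_N(\mathbb{R}^\infty))/G$ and induce the map in the claim. *)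

theory Defs
  imports "HOL-Homology.Homology" "HOL-Algebra.Group_Action" "HOL-Library.Z2"
begin

section \<open>Polynomials\<close>

text \<open>
  Real polynomials are identified with polynomial functions. Points of \<open>\<real>\<^sup>n\<close> are
  functions of type \<^typ>\<open>nat \<Rightarrow> real\<close> that vanish from index \<open>n\<close> on, as in
  \<^const>\<open>Euclidean_space\<close>. A polynomial in \<open>n\<close> variables is a function on the whole type which
  depends on the first \<open>n\<close> coordinates only, so a polynomial on \<open>\<real>\<^sup>n\<close> is literally also a
  polynomial on \<open>\<real>\<^sup>n\<^sup>+\<^sup>1\<close>.
\<close>

inductive_set real_algebra_generated :: "('a \<Rightarrow> real) set \<Rightarrow> ('a \<Rightarrow> real) set"
  for S :: "('a \<Rightarrow> real) set" where
  const: "(\<lambda>_. c) \<in> real_algebra_generated S"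
| gen: "f \<in> S \<Longrightarrow> f \<in> real_algebra_generated S"
| add: "\<lbrakk>f \<in> real_algebra_generated S; h \<in> real_algebra_generated S\<rbrakk>
    \<Longrightarrow> (\<lambda>x. f x + h x) \<in> real_algebra_generated S"
| mult: "\<lbrakk>f \<in> real_algebra_generated S; h \<in> real_algebra_generated S\<rbrakk>
    \<Longrightarrow> (\<lambda>x. f x * h x) \<in> real_algebra_generated S"

definition polynomials :: "nat \<Rightarrow> ((nat \<Rightarrow> real) \<Rightarrow> real) set" where
  "polynomials n = real_algebra_generated {\<lambda>x. x i | i. i < n}"

definition homogeneous_poly :: "nat \<Rightarrow> nat \<Rightarrow> ((nat \<Rightarrow> real) \<Rightarrow> real) \<Rightarrow> bool" where
  "homogeneous_poly n r F \<longleftrightarrow>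
     F \<in> polynomials n \<and> (\<forall>c v. F (\<lambda>i. c * v i) = c ^ r * F v)"

inductive_set semialgebraic :: "nat \<Rightarrow> (nat \<Rightarrow> real) set set" for n :: nat where
  pos: "f \<in> polynomials n \<Longrightarrow>
    {x \<in> topspace (Euclidean_space n). f x > 0} \<in> semialgebraic n"
| union: "\<lbrakk>A \<in> semialgebraic n; B \<in> semialgebraic n\<rbrakk> \<Longrightarrow> A \<union> B \<in> semialgebraic n"
| compl: "A \<in> semialgebraic n \<Longrightarrow> topspace (Euclidean_space n) - A \<in> semialgebraic n"


section \<open>Real projective space\<close>

text \<open>
  A point of \<open>\<bbbP>\<^sup>d(\<real>)\<close> is the set of all its homogeneous coordinate vectors, which lie in
  \<open>\<real>\<^sup>d\<^sup>+\<^sup>1\<close> with coordinates numbered \<open>0, \<dots>, d\<close>.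
\<close>

definition hom_coords :: "nat \<Rightarrow> (nat \<Rightarrow> real) set" where
  "hom_coords d = topspace (Euclidean_space (Suc d)) - {\<lambda>_. 0}"

definition proj_point :: "(nat \<Rightarrow> real) \<Rightarrow> (nat \<Rightarrow> real) set" where
  "proj_point v = {\<lambda>i. c * v i | c. c \<noteq> 0}"

definition proj_space :: "nat \<Rightarrow> (nat \<Rightarrow> real) set set" where
  "proj_space d = proj_point ` hom_coords d"

definition affine_embed :: "(nat \<Rightarrow> real) \<Rightarrow> (nat \<Rightarrow> real) set" where
  "affine_embed x = proj_point (\<lambda>i. case i of 0 \<Rightarrow> 1 | Suc j \<Rightarrow> x j)"

text \<open>Semialgebraicity of a subset of \<open>\<bbbP>\<^sup>d(\<real>)\<close> is read off its punctured affine cone.\<close>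

definition proj_semialgebraic :: "nat \<Rightarrow> (nat \<Rightarrow> real) set set \<Rightarrow> bool" where
  "proj_semialgebraic d A \<longleftrightarrow> A \<subseteq> proj_space d \<and>
     {v \<in> hom_coords d. proj_point v \<in> A} \<in> semialgebraic (Suc d)"

definition proj_zariski_closure :: "nat \<Rightarrow> (nat \<Rightarrow> real) set set \<Rightarrow> (nat \<Rightarrow> real) set set" where
  "proj_zariski_closure d A =
     {proj_point v | v. v \<in> hom_coords d \<and>
        (\<forall>r F. homogeneous_poly (Suc d) r F \<and> (\<forall>w \<in> hom_coords d. proj_point w \<in> A \<longrightarrow> F w = 0)
           \<longrightarrow> F v = 0)}"

definition affine_zariski_closure :: "nat \<Rightarrow> (nat \<Rightarrow> real) set \<Rightarrow> (nat \<Rightarrow> real) set" where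
  "affine_zariski_closure d X =
     {x \<in> topspace (Euclidean_space d). \<forall>f \<in> polynomials d. (\<forall>a \<in> X. f a = 0) \<longrightarrow> f x = 0}"

text \<open>
  Regular maps between subsets of projective spaces, in the sense of real algebraic geometry:
  Zariski-locally around every real point of the source, the map is given by forms of one common
  degree without a common real zero there. (The locus where the forms do not all vanish is the
  Zariski neighbourhood; any smaller neighbourhood can be obtained by multiplying all forms by one
  more form.)
\<close>

definition regular_map ::
    "nat \<Rightarrow> nat \<Rightarrow> (nat \<Rightarrow> real) set set \<Rightarrow> ((nat \<Rightarrow> real) set \<Rightarrow> (nat \<Rightarrow> real) set) \<Rightarrow> bool" where
  "regular_map d d' Z f \<longleftrightarrow>
     Z \<subseteq> proj_space d \<and> f ` Z \<subseteq> proj_space d' \<and>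
     (\<forall>v \<in> hom_coords d. proj_point v \<in> Z \<longrightarrow>
        (\<exists>r F. (\<forall>i\<le>d'. homogeneous_poly (Suc d) r (F i)) \<and> (\<exists>i\<le>d'. F i v \<noteq> 0) \<and>
           (\<forall>w \<in> hom_coords d. proj_point w \<in> Z \<and> (\<exists>i\<le>d'. F i w \<noteq> 0) \<longrightarrow>
              f (proj_point w) = proj_point (\<lambda>i. if i \<le> d' then F i w else 0))))"

definition biregular_iso ::
    "nat \<Rightarrow> nat \<Rightarrow> (nat \<Rightarrow> real) set set \<Rightarrow> (nat \<Rightarrow> real) set set \<Rightarrow>
     ((nat \<Rightarrow> real) set \<Rightarrow> (nat \<Rightarrow> real) set) \<Rightarrow> bool" where
  "biregular_iso d d' Z Z' f \<longleftrightarrow>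
     bij_betw f Z Z' \<and> regular_map d d' Z f \<and> regular_map d' d Z' (inv_into Z f)"


section \<open>AS-sets and group actions on them\<close>

text \<open>An arc is analytic if it lifts, locally, to analytic homogeneous coordinates.\<close>

definition analytic_arc :: "nat \<Rightarrow> (real \<Rightarrow> (nat \<Rightarrow> real) set) \<Rightarrow> bool" where
  "analytic_arc d \<gamma> \<longleftrightarrow>
     (\<forall>t \<in> {-1<..<1}. \<exists>r>0. \<exists>a v. \<forall>s \<in> {-1<..<1}. \<bar>s - t\<bar> < r \<longrightarrow>
        v s \<in> hom_coords d \<and> \<gamma> s = proj_point (v s) \<and>
        (\<forall>i\<le>d. (\<lambda>n. a i n * (s - t) ^ n) sums v s i))"

definition arc_symmetric :: "nat \<Rightarrow> (nat \<Rightarrow> real) set set \<Rightarrow> bool" where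
  "arc_symmetric d A \<longleftrightarrow> proj_semialgebraic d A \<and>
     (\<forall>\<gamma>. analytic_arc d \<gamma> \<and> \<gamma> ` {-1<..<0} \<subseteq> A \<longrightarrow> \<gamma> ` {-1<..<1} \<subseteq> A)"

inductive_set AS_sets :: "nat \<Rightarrow> (nat \<Rightarrow> real) set set set" for d :: nat where
  arc_sym: "arc_symmetric d A \<Longrightarrow> A \<in> AS_sets d"
| union: "\<lbrakk>A \<in> AS_sets d; B \<in> AS_sets d\<rbrakk> \<Longrightarrow> A \<union> B \<in> AS_sets d"
| compl: "A \<in> AS_sets d \<Longrightarrow> proj_space d - A \<in> AS_sets d"

definition G_AS_set ::
    "('g, 'b) monoid_scheme \<Rightarrow> nat \<Rightarrow> ('g \<Rightarrow> (nat \<Rightarrow> real) set \<Rightarrow> (nat \<Rightarrow> real) set) \<Rightarrow>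
     (nat \<Rightarrow> real) set set \<Rightarrow> bool" where
  "G_AS_set G e \<alpha> Y \<longleftrightarrow> Y \<in> AS_sets e \<and>
     group_action G (proj_zariski_closure e Y) \<alpha> \<and>
     (\<forall>g \<in> carrier G.
        biregular_iso e e (proj_zariski_closure e Y) (proj_zariski_closure e Y) (\<alpha> g) \<and>
        \<alpha> g ` Y = Y)"

text \<open>
  An action \<open>\<sigma>\<close> of \<open>G\<close> on the index set \<open>{..<d}\<close> acts linearly on \<open>\<real>\<^sup>d\<close> by sending the \<open>j\<close>-th
  basis vector to the \<open>\<sigma> g j\<close>-th one.
\<close>

definition coord_act ::
    "('g, 'b) monoid_scheme \<Rightarrow> nat \<Rightarrow> ('g \<Rightarrow> nat \<Rightarrow> nat) \<Rightarrow> 'g \<Rightarrow> (nat \<Rightarrow> real) \<Rightarrow> nat \<Rightarrow> real" where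
  "coord_act G d \<sigma> g x = (\<lambda>i. if i < d then x (\<sigma> (inv\<^bsub>G\<^esub> g) i) else 0)"

text \<open>
  \<open>X \<subseteq> \<real>\<^sup>d\<close>, with the action of \<open>G\<close> by the coordinate permutations \<open>\<sigma>\<close>, realizes the
  \<open>G\<close>-AS-set \<open>Y\<close> through the equivariant biregular isomorphism \<open>\<phi>\<close> of Zariski closures.
\<close>

definition affine_realization ::
    "('g, 'b) monoid_scheme \<Rightarrow> nat \<Rightarrow> ('g \<Rightarrow> (nat \<Rightarrow> real) set \<Rightarrow> (nat \<Rightarrow> real) set) \<Rightarrow>
     (nat \<Rightarrow> real) set set \<Rightarrow> nat \<Rightarrow> ('g \<Rightarrow> nat \<Rightarrow> nat) \<Rightarrow> (nat \<Rightarrow> real) set \<Rightarrow>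
     ((nat \<Rightarrow> real) set \<Rightarrow> nat \<Rightarrow> real) \<Rightarrow> bool" where
  "affine_realization G e \<alpha> Y d \<sigma> X \<phi> \<longleftrightarrow>
     X \<subseteq> topspace (Euclidean_space d) \<and>
     affine_embed ` X \<in> AS_sets d \<and>
     compactin (Euclidean_space d) (affine_zariski_closure d X) \<and>
     group_action G {..<d} \<sigma> \<and>
     biregular_iso e d (proj_zariski_closure e Y) (affine_embed ` affine_zariski_closure d X)
       (affine_embed \<circ> \<phi>) \<and>
     \<phi> ` Y = X \<and>
     (\<forall>g \<in> carrier G. \<forall>y \<in> proj_zariski_closure e Y. \<phi> (\<alpha> g y) = coord_act G d \<sigma> g (\<phi> y))"


section \<open>Final topologies\<close>

text \<open>
  The final topology on the union of the images of the maps \<open>f i\<close>; it is used both for the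
  direct limit of an increasing sequence of spaces and for orbit spaces.
\<close>

definition final_topology :: "('i \<Rightarrow> 'a topology) \<Rightarrow> ('i \<Rightarrow> 'a \<Rightarrow> 'b) \<Rightarrow> 'b topology" where
  "final_topology T f = topology (\<lambda>U. U \<subseteq> (\<Union>i. f i ` topspace (T i)) \<and>
     (\<forall>i. openin (T i) {x \<in> topspace (T i). f i x \<in> U}))"

lemma openin_final_topology:
  "openin (final_topology T f) U \<longleftrightarrow> U \<subseteq> (\<Union>i. f i ` topspace (T i)) \<and>
     (\<forall>i. openin (T i) {x \<in> topspace (T i). f i x \<in> U})"
proof -
  let ?P = "\<lambda>U. U \<subseteq> (\<Union>i. f i ` topspace (T i)) \<and>
     (\<forall>i. openin (T i) {x \<in> topspace (T i). f i x \<in> U})"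
  have "istopology ?P"
    unfolding istopology_def
  proof (intro conjI allI impI)
    fix S U assume "?P S" "?P U"
    then show "S \<inter> U \<subseteq> (\<Union>i. f i ` topspace (T i))"
      by blast
  next
    fix S U i assume "?P S" "?P U"
    then have "openin (T i) ({x \<in> topspace (T i). f i x \<in> S} \<inter> {x \<in> topspace (T i). f i x \<in> U})"
      by blast
    then show "openin (T i) {x \<in> topspace (T i). f i x \<in> S \<inter> U}"
      by (rule back_subst) auto
  next
    fix K assume K: "\<forall>S\<in>K. ?P S"
    show "\<Union>K \<subseteq> (\<Union>i. f i ` topspace (T i))"
      using K by (intro Union_least) blast
    fix i
    have "openin (T i) (\<Union>S\<in>K. {x \<in> topspace (T i). f i x \<in> S})"
      using K by (intro openin_Union) auto
    then show "openin (T i) {x \<in> topspace (T i). f i x \<in> \<Union>K}"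
      by (rule back_subst) auto
  qed
  then show ?thesis
    by (simp add: final_topology_def)
qed


section \<open>Stiefel manifolds and the Borel construction\<close>

text \<open>
  Matrices are functions of a pair (row, column), zero outside the given number of rows and
  columns, so adding a zero row is the identity. A real \<open>k \<times> N\<close> matrix \<open>A\<close> is in the Stiefel
  manifold iff its \<open>N\<close> columns are orthonormal.
\<close>

definition matrices :: "nat \<Rightarrow> nat \<Rightarrow> (nat \<times> nat \<Rightarrow> real) set" where
  "matrices k N = {A. \<forall>i j. i \<ge> k \<or> j \<ge> N \<longrightarrow> A (i, j) = 0}"

definition stiefel_set :: "nat \<Rightarrow> nat \<Rightarrow> (nat \<times> nat \<Rightarrow> real) set" where
  "stiefel_set N k =
     {A \<in> matrices k N. \<forall>a<N. \<forall>b<N. (\<Sum>i<k. A (i, a) * A (i, b)) = (if a = b then 1 else 0)}"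

definition stiefel :: "nat \<Rightarrow> nat \<Rightarrow> (nat \<times> nat \<Rightarrow> real) topology" where
  "stiefel N k = subtopology (powertop_real UNIV) (stiefel_set N k)"

definition stiefel_inf :: "nat \<Rightarrow> (nat \<times> nat \<Rightarrow> real) topology" where
  "stiefel_inf N = final_topology (stiefel N) (\<lambda>_. id)"

definition perm_matrix :: "('g \<Rightarrow> nat \<Rightarrow> nat) \<Rightarrow> 'g \<Rightarrow> nat \<times> nat \<Rightarrow> real" where
  "perm_matrix \<tau> g = (\<lambda>(l, j). if l = \<tau> g j then 1 else 0)"

text \<open>The action \<open>g \<cdot> A = A g\<^sup>-\<^sup>1\<close>, for \<open>G\<close> embedded by the permutation matrices of \<open>\<tau>\<close>.\<close>

definition stiefel_act ::
    "('g, 'b) monoid_scheme \<Rightarrow> nat \<Rightarrow> ('g \<Rightarrow> nat \<Rightarrow> nat) \<Rightarrow> 'g \<Rightarrow>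
     (nat \<times> nat \<Rightarrow> real) \<Rightarrow> nat \<times> nat \<Rightarrow> real" where
  "stiefel_act G N \<tau> g A =
     (\<lambda>(i, j). if j < N then \<Sum>l<N. A (i, l) * perm_matrix \<tau> (inv\<^bsub>G\<^esub> g) (l, j) else 0)"

type_synonym point = "(nat \<Rightarrow> real) \<times> (nat \<times> nat \<Rightarrow> real)"

definition diag_act ::
    "('g, 'b) monoid_scheme \<Rightarrow> nat \<Rightarrow> nat \<Rightarrow> ('g \<Rightarrow> nat \<Rightarrow> nat) \<Rightarrow> ('g \<Rightarrow> nat \<Rightarrow> nat) \<Rightarrow>
     'g \<Rightarrow> point \<Rightarrow> point" where
  "diag_act G d N \<sigma> \<tau> g = (\<lambda>(x, A). (coord_act G d \<sigma> g x, stiefel_act G N \<tau> g A))"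

definition borel_construction ::
    "('g, 'b) monoid_scheme \<Rightarrow> nat \<Rightarrow> nat \<Rightarrow> ('g \<Rightarrow> nat \<Rightarrow> nat) \<Rightarrow> ('g \<Rightarrow> nat \<Rightarrow> nat) \<Rightarrow>
     (nat \<Rightarrow> real) set \<Rightarrow> point set topology" where
  "borel_construction G d N \<sigma> \<tau> X =
     final_topology
       (\<lambda>_::unit. prod_topology (subtopology (Euclidean_space d) X) (stiefel_inf N))
       (\<lambda>_. orbit G (diag_act G d N \<sigma> \<tau>))"


section \<open>Geometric quotients by invariant polynomials\<close>

definition mixed_polynomials :: "nat \<Rightarrow> nat \<Rightarrow> nat \<Rightarrow> (point \<Rightarrow> real) set" where
  "mixed_polynomials d N k = real_algebra_generated
     ({\<lambda>(x, A). x i | i. i < d} \<union> {\<lambda>(x, A). A (i, j) | i j. i < k \<and> j < N})"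

definition invariant_polynomials ::
    "('g, 'b) monoid_scheme \<Rightarrow> nat \<Rightarrow> nat \<Rightarrow> ('g \<Rightarrow> nat \<Rightarrow> nat) \<Rightarrow> ('g \<Rightarrow> nat \<Rightarrow> nat) \<Rightarrow>
     nat \<Rightarrow> (point \<Rightarrow> real) set" where
  "invariant_polynomials G d N \<sigma> \<tau> k = {f \<in> mixed_polynomials d N k.
     \<forall>g \<in> carrier G. \<forall>z \<in> topspace (Euclidean_space d) \<times> matrices k N.
       f (diag_act G d N \<sigma> \<tau> g z) = f z}"

text \<open>
  For each \<open>k\<close>, the \<open>p k i\<close> with \<open>i < m k\<close> are generators of the invariant polynomials on
  \<open>\<real>\<^sup>d \<times> \<real>\<^sup>k\<^sup>N\<close>; those for \<open>k + 1\<close> extend those for \<open>k\<close> by polynomials that vanish when the new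
  row of coordinates is zero.
\<close>

definition compatible_generators ::
    "('g, 'b) monoid_scheme \<Rightarrow> nat \<Rightarrow> nat \<Rightarrow> ('g \<Rightarrow> nat \<Rightarrow> nat) \<Rightarrow> ('g \<Rightarrow> nat \<Rightarrow> nat) \<Rightarrow>
     (nat \<Rightarrow> nat) \<Rightarrow> (nat \<Rightarrow> nat \<Rightarrow> point \<Rightarrow> real) \<Rightarrow> bool" where
  "compatible_generators G d N \<sigma> \<tau> m p \<longleftrightarrow>
     (\<forall>k. real_algebra_generated (p k ` {..<m k}) = invariant_polynomials G d N \<sigma> \<tau> k) \<and>
     (\<forall>k. m k \<le> m (Suc k)) \<and>
     (\<forall>k. \<forall>i<m k. p (Suc k) i = p k i) \<and>
     (\<forall>k. \<forall>i \<in> {m k..<m (Suc k)}. \<forall>z \<in> topspace (Euclidean_space d) \<times> matrices k N.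
        p (Suc k) i z = 0)"

definition quot_map :: "(nat \<Rightarrow> nat) \<Rightarrow> (nat \<Rightarrow> nat \<Rightarrow> point \<Rightarrow> real) \<Rightarrow> nat \<Rightarrow> point \<Rightarrow> nat \<Rightarrow> real" where
  "quot_map m p k z = (\<lambda>i. if i < m k then p k i z else 0)"

definition quot_space ::
    "nat \<Rightarrow> (nat \<Rightarrow> real) set \<Rightarrow> (nat \<Rightarrow> nat) \<Rightarrow> (nat \<Rightarrow> nat \<Rightarrow> point \<Rightarrow> real) \<Rightarrow> nat \<Rightarrow>
     (nat \<Rightarrow> real) topology" where
  "quot_space N X m p k =
     subtopology (Euclidean_space (m k)) (quot_map m p k ` (X \<times> stiefel_set N k))"

text \<open>
  The map \<open>q z \<mapsto> f z\<close> on \<open>q ` S\<close>; meaningful only if \<open>f\<close> is constant on the fibres of \<open>q\<close> in \<open>S\<close>.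
\<close>

definition descend :: "'a set \<Rightarrow> ('a \<Rightarrow> 'b) \<Rightarrow> ('a \<Rightarrow> 'c) \<Rightarrow> 'b \<Rightarrow> 'c" where
  "descend S q f y = (THE w. \<exists>z \<in> S. y = q z \<and> w = f z)"

definition quot_incl ::
    "nat \<Rightarrow> (nat \<Rightarrow> real) set \<Rightarrow> (nat \<Rightarrow> nat) \<Rightarrow> (nat \<Rightarrow> nat \<Rightarrow> point \<Rightarrow> real) \<Rightarrow> nat \<Rightarrow>
     (nat \<Rightarrow> real) \<Rightarrow> nat \<Rightarrow> real" where
  "quot_incl N X m p k =
     descend (X \<times> stiefel_set N k) (quot_map m p k) (quot_map m p (Suc k))"

definition quot_to_borel ::
    "('g, 'b) monoid_scheme \<Rightarrow> nat \<Rightarrow> nat \<Rightarrow> ('g \<Rightarrow> nat \<Rightarrow> nat) \<Rightarrow> ('g \<Rightarrow> nat \<Rightarrow> nat) \<Rightarrow>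
     (nat \<Rightarrow> real) set \<Rightarrow> (nat \<Rightarrow> nat) \<Rightarrow> (nat \<Rightarrow> nat \<Rightarrow> point \<Rightarrow> real) \<Rightarrow> nat \<Rightarrow>
     (nat \<Rightarrow> real) \<Rightarrow> point set" where
  "quot_to_borel G d N \<sigma> \<tau> X m p k =
     descend (X \<times> stiefel_set N k) (quot_map m p k) (orbit G (diag_act G d N \<sigma> \<tau>))"


section \<open>Singular cohomology with coefficients in the field of two elements\<close>

text \<open>
  A cochain is a function on singular simplices with values in \<^typ>\<open>bit\<close>, extended by zero to
  the rest of the type. The signs \<open>(-1)\<^sup>k\<close> in the coboundary are all equal to 1.
\<close>

definition cochain_group :: "nat \<Rightarrow> 'a topology \<Rightarrow> (((nat \<Rightarrow> real) \<Rightarrow> 'a) \<Rightarrow> bit) monoid" where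
  "cochain_group n T =
     \<lparr>carrier = {c. \<forall>s. \<not> singular_simplex n T s \<longrightarrow> c s = 0},
      monoid.mult = (\<lambda>c c' s. c s + c' s),
      one = (\<lambda>_. 0)\<rparr>"

definition coboundary ::
    "nat \<Rightarrow> 'a topology \<Rightarrow> (((nat \<Rightarrow> real) \<Rightarrow> 'a) \<Rightarrow> bit) \<Rightarrow> ((nat \<Rightarrow> real) \<Rightarrow> 'a) \<Rightarrow> bit" where
  "coboundary n T c =
     (\<lambda>s. if singular_simplex (Suc n) T s then \<Sum>k\<le>Suc n. c (singular_face (Suc n) k s) else 0)"

definition cocycle_group :: "nat \<Rightarrow> 'a topology \<Rightarrow> (((nat \<Rightarrow> real) \<Rightarrow> 'a) \<Rightarrow> bit) monoid" where
  "cocycle_group n T =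
     (cochain_group n T)\<lparr>carrier := {c \<in> carrier (cochain_group n T). coboundary n T c = (\<lambda>_. 0)}\<rparr>"

definition coboundary_set :: "nat \<Rightarrow> 'a topology \<Rightarrow> (((nat \<Rightarrow> real) \<Rightarrow> 'a) \<Rightarrow> bit) set" where
  "coboundary_set n T =
     (case n of 0 \<Rightarrow> {\<lambda>_. 0} | Suc j \<Rightarrow> coboundary j T ` carrier (cochain_group j T))"

definition cohomology_group :: "nat \<Rightarrow> 'a topology \<Rightarrow> (((nat \<Rightarrow> real) \<Rightarrow> 'a) \<Rightarrow> bit) set monoid" where
  "cohomology_group n T = cocycle_group n T Mod coboundary_set n T"

definition cochain_map ::
    "nat \<Rightarrow> 'a topology \<Rightarrow> ('a \<Rightarrow> 'b) \<Rightarrow>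
     (((nat \<Rightarrow> real) \<Rightarrow> 'b) \<Rightarrow> bit) \<Rightarrow> ((nat \<Rightarrow> real) \<Rightarrow> 'a) \<Rightarrow> bit" where
  "cochain_map n T f c = (\<lambda>s. if singular_simplex n T s then c (simplex_map n f s) else 0)"

text \<open>
  For continuous \<open>f\<close> with domain \<open>T\<close>, the class of the pulled back cocycle does not depend on the
  representative, so the union is over a single coset.
\<close>

definition cohomology_map ::
    "nat \<Rightarrow> 'a topology \<Rightarrow> ('a \<Rightarrow> 'b) \<Rightarrow>
     (((nat \<Rightarrow> real) \<Rightarrow> 'b) \<Rightarrow> bit) set \<Rightarrow> (((nat \<Rightarrow> real) \<Rightarrow> 'a) \<Rightarrow> bit) set" where
  "cohomology_map n T f K =
     (\<Union>c \<in> K. coboundary_set n T #>\<^bsub>cocycle_group n T\<^esub> cochain_map n T f c)"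

definition inverse_limit_group ::
    "(nat \<Rightarrow> ('a, 'b) monoid_scheme) \<Rightarrow> (nat \<Rightarrow> 'a \<Rightarrow> 'a) \<Rightarrow> (nat \<Rightarrow> 'a) monoid" where
  "inverse_limit_group H r =
     (product_group UNIV H)
       \<lparr>carrier := {a \<in> carrier (product_group UNIV H). \<forall>k. r k (a (Suc k)) = a k}\<rparr>"

end

theory Submission
  imports Defs
begin

text \<open>
  The isomorphism is the statement that singular cohomology with coefficients in a finite field turns
  a suitable sequential union of spaces into a projective limit
  (\<open>cohomology_iso_inverse_limit\<close>), applied to the Borel construction as the union of the quotients
  \<open>X(k)\<close>.

  For the algebra, let the space \<open>B\<close> be a union of injective images of spaces \<open>T k\<close> such that every
  singular simplex of \<open>B\<close> comes from some \<open>T k\<close>. A cochain on \<open>B\<close> is then the same as a compatible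
  sequence of cochains on the \<open>T k\<close>, and restriction of cochains from \<open>T (k + 1)\<close> to \<open>T k\<close> is
  surjective, since cochains extend by zero. So compatible classes can be represented by compatible
  cocycles, which glue: this is surjectivity. The kernel in degree \<open>n\<close> is the derived limit of the
  cohomology in degree \<open>n - 1\<close>, and it vanishes by Tychonoff's theorem. If a cocycle is a coboundary
  on every \<open>T k\<close>, then the functions on the simplices of \<open>B\<close> with values in \<open>{0, 1}\<close> that are
  primitives on \<open>T k\<close> form a decreasing sequence of non-empty closed subsets of a compact space, and
  a function in all of them is a primitive on \<open>B\<close> (\<open>coboundary_if_locally_coboundary\<close>).

  For the geometry, two points of \<open>X \<times> V\<^sub>N(\<real>\<^sup>k)\<close> have the same image in \<open>X(k)\<close> iff they are in one
  orbit, because the product of the squared distances from a fixed point to the translates of a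
  variable one is an invariant polynomial (\<open>orbit_separating_polynomial\<close>). The Zariski closure of
  \<open>X\<close> and the Stiefel manifold are compact, so the quotient map onto \<open>X(k)\<close> is closed
  (\<open>quotient_map_quot\<close>), and the maps that are defined on \<open>X(k)\<close> through orbits are continuous. Since
  the new generators vanish where the new row of the matrix is zero, the inclusion of \<open>X(k)\<close> in the
  next quotient is the identity on points.

  What remains is to lift simplices. A compact subset of the Borel construction lies over finitely
  many rows (\<open>compactin_borel_stage\<close>), because a set of matrices that meets each \<open>V\<^sub>N(\<real>\<^sup>k)\<close> in a
  finite set is closed in \<open>V\<^sub>N(\<real>\<^sup>\<infinity>)\<close>. The generators for \<open>k\<close> read only the first \<open>k\<close> rows while the
  group permutes columns, so they define continuous functions on the whole Borel construction, and
  these functions invert \<open>X(k)\<close> \<open>\<rightarrow>\<close> \<open>(X \<times> V\<^sub>N(\<real>\<^sup>\<infinity>)) / G\<close> on its image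
  (\<open>borel_left_inverse\<close>).
\<close>


section \<open>Singular cohomology with mod 2 coefficients\<close>

(* These rules turn sums of bits into Boolean operations; cochains are manipulated by the group laws. *)
declare add_bit_eq_xor [simp del] mult_bit_eq_and [simp del] minus_bit_def [simp del]

lemma bit_add_self [simp]: "(a::bit) + a = 0"
  by (cases a) auto

lemma mem_cochain_group:
  "c \<in> carrier (cochain_group n T) \<longleftrightarrow> (\<forall>s. \<not> singular_simplex n T s \<longrightarrow> c s = 0)"
  by (simp add: cochain_group_def)

lemma mem_cocycle_group:
  "c \<in> carrier (cocycle_group n T) \<longleftrightarrow>
     c \<in> carrier (cochain_group n T) \<and> coboundary n T c = (\<lambda>_. 0)"
  by (simp add: cocycle_group_def)

lemma zero_in_cochain_group: "(\<lambda>_. 0) \<in> carrier (cochain_group n T)"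
  by (simp add: mem_cochain_group)

lemma mult_cocycle_group: "c \<otimes>\<^bsub>cocycle_group n T\<^esub> c' = (\<lambda>s. c s + c' s)"
  by (simp add: cocycle_group_def cochain_group_def)

lemma one_cocycle_group: "\<one>\<^bsub>cocycle_group n T\<^esub> = (\<lambda>_. 0)"
  by (simp add: cocycle_group_def cochain_group_def)

lemma coboundary_add:
  "coboundary n T (\<lambda>s. c s + c' s) = (\<lambda>s. coboundary n T c s + coboundary n T c' s)"
  by (auto simp: coboundary_def sum.distrib)

lemma coboundary_zero: "coboundary n T (\<lambda>_. 0) = (\<lambda>_. 0)"
  by (auto simp: coboundary_def)

lemma coboundary_in_cochain_group: "coboundary n T c \<in> carrier (cochain_group (Suc n) T)"
  by (auto simp: coboundary_def mem_cochain_group)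

lemma singular_face_singular_face:
  assumes "i \<le> l" "l \<le> Suc n"
  shows "singular_face (Suc n) i (singular_face (Suc (Suc n)) (Suc l) s) =
         singular_face (Suc n) l (singular_face (Suc (Suc n)) i s)"
proof (rule ext)
  fix t
  show "singular_face (Suc n) i (singular_face (Suc (Suc n)) (Suc l) s) t =
        singular_face (Suc n) l (singular_face (Suc (Suc n)) i s) t"
  proof (cases "t \<in> standard_simplex n")
    case True
    have "simplical_face i t \<in> standard_simplex (Suc n)"
      using assms True simplical_face_in_standard_simplex[of "Suc n" i t] by simp
    moreover have "simplical_face l t \<in> standard_simplex (Suc n)"
      using assms True simplical_face_in_standard_simplex[of "Suc n" l t] by simp
    moreover have "simplical_face (Suc l) (simplical_face i t) = simplical_face i (simplical_face l t)"
      using assms True unfolding standard_simplex_def simplical_face_def by fastforce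
    ultimately show ?thesis
      using True by (simp add: singular_face_def)
  qed (simp add: singular_face_def)
qed

text \<open>Deleting two vertices in either order gives the same face, so the double coboundary counts
  each face of codimension two twice.\<close>

lemma coboundary_coboundary: "coboundary (Suc n) T (coboundary n T c) = (\<lambda>_. 0)"
proof (rule ext)
  fix s
  show "coboundary (Suc n) T (coboundary n T c) s = 0"
  proof (cases "singular_simplex (Suc (Suc n)) T s")
    case True
    let ?F = "\<lambda>(k, i). c (singular_face (Suc n) i (singular_face (Suc (Suc n)) k s))"
    let ?I = "{..Suc (Suc n)} \<times> {..Suc n}"
    have "singular_simplex (Suc n) T (singular_face (Suc (Suc n)) k s)" if "k \<le> Suc (Suc n)" for k
      using singular_simplex_singular_face[OF True _ that] by simp
    then have "coboundary (Suc n) T (coboundary n T c) s =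
        (\<Sum>k\<le>Suc (Suc n). \<Sum>i\<le>Suc n. ?F (k, i))"
      using True unfolding coboundary_def by (auto intro!: sum.cong simp del: sum.atMost_Suc)
    also have "\<dots> = sum ?F ?I"
      by (subst sum.cartesian_product) simp
    also have "\<dots> = sum ?F (?I \<inter> {(k, i). i < k}) + sum ?F (?I - {(k, i). i < k})"
      by (rule sum.Int_Diff) auto
    also have "sum ?F (?I \<inter> {(k, i). i < k}) = sum ?F (?I - {(k, i). i < k})"
    proof (rule sum.reindex_bij_witness[where i = "\<lambda>(k, i). (Suc i, k)" and j = "\<lambda>(k, i). (i, k - 1)"])
      fix a assume "a \<in> ?I \<inter> {(k, i). i < k}"
      then obtain l i where "a = (Suc l, i)" "i \<le> l" "l \<le> Suc n"
        by (cases a; case_tac "fst a") auto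
      then show "?F (case a of (k, i) \<Rightarrow> (i, k - 1)) = ?F a"
        by (simp add: singular_face_singular_face)
    qed auto
    finally show ?thesis
      by simp
  qed (simp add: coboundary_def)
qed

lemma cocycle_add:
  assumes "c \<in> carrier (cocycle_group n T)" "c' \<in> carrier (cocycle_group n T)"
  shows "(\<lambda>s. c s + c' s) \<in> carrier (cocycle_group n T)"
  using assms by (auto simp: mem_cocycle_group mem_cochain_group coboundary_add)

lemma comm_group_cocycle_group: "comm_group (cocycle_group n T)"
proof (rule comm_groupI; unfold mult_cocycle_group one_cocycle_group)
  fix c assume "c \<in> carrier (cocycle_group n T)"
  then show "\<exists>c'\<in>carrier (cocycle_group n T). (\<lambda>s. c' s + c s) = (\<lambda>_. 0)"
    by (intro bexI[of _ c]) auto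
qed (auto simp: mem_cocycle_group mem_cochain_group coboundary_add coboundary_zero ac_simps)

lemma mem_coboundary_set_Suc:
  "x \<in> coboundary_set (Suc n) T \<longleftrightarrow> (\<exists>b\<in>carrier (cochain_group n T). x = coboundary n T b)"
  by (auto simp: coboundary_set_def)

lemma mem_coboundary_set_0: "x \<in> coboundary_set 0 T \<longleftrightarrow> x = (\<lambda>_. 0)"
  by (auto simp: coboundary_set_def)

lemma subgroup_coboundary_set: "subgroup (coboundary_set n T) (cocycle_group n T)"
proof -
  interpret comm_group "cocycle_group n T"
    by (rule comm_group_cocycle_group)
  have inv: "inv\<^bsub>cocycle_group n T\<^esub> c = c" if "c \<in> carrier (cocycle_group n T)" for c
    using that by (intro inv_equality) (auto simp: mult_cocycle_group one_cocycle_group)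
  have sub: "coboundary_set n T \<subseteq> carrier (cocycle_group n T)"
    by (cases n) (auto simp: mem_coboundary_set_Suc mem_coboundary_set_0 mem_cocycle_group
        coboundary_in_cochain_group coboundary_coboundary coboundary_zero zero_in_cochain_group)
  show ?thesis
  proof (rule subgroupI[OF sub])
    show "coboundary_set n T \<noteq> {}"
      by (cases n) (auto simp: coboundary_set_def mem_cochain_group)
    fix x assume x: "x \<in> coboundary_set n T"
    then show "inv\<^bsub>cocycle_group n T\<^esub> x \<in> coboundary_set n T"
      using inv sub by auto
    fix y assume y: "y \<in> coboundary_set n T"
    show "x \<otimes>\<^bsub>cocycle_group n T\<^esub> y \<in> coboundary_set n T"
    proof (cases n)
      case 0
      then show ?thesis
        using x y by (auto simp: mem_coboundary_set_0 mult_cocycle_group)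
    next
      case (Suc l)
      then obtain b b' where "b \<in> carrier (cochain_group l T)" "x = coboundary l T b"
        "b' \<in> carrier (cochain_group l T)" "y = coboundary l T b'"
        using x y by (auto simp: mem_coboundary_set_Suc)
      then show ?thesis
        unfolding Suc mem_coboundary_set_Suc mult_cocycle_group
        by (intro bexI[of _ "\<lambda>s. b s + b' s"]) (auto simp: coboundary_add mem_cochain_group)
    qed
  qed
qed

lemma normal_coboundary_set: "coboundary_set n T \<lhd> cocycle_group n T"
  by (simp add: comm_group.subgroup_imp_normal comm_group_cocycle_group subgroup_coboundary_set)

definition cohomology_class ::
    "nat \<Rightarrow> 'a topology \<Rightarrow> (((nat \<Rightarrow> real) \<Rightarrow> 'a) \<Rightarrow> bit) \<Rightarrow> (((nat \<Rightarrow> real) \<Rightarrow> 'a) \<Rightarrow> bit) set" where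
  "cohomology_class n T c = coboundary_set n T #>\<^bsub>cocycle_group n T\<^esub> c"

lemma carrier_cohomology_group:
  "carrier (cohomology_group n T) = cohomology_class n T ` carrier (cocycle_group n T)"
  by (simp add: cohomology_group_def cohomology_class_def[abs_def] carrier_FactGroup)

lemma mult_cohomology_class:
  assumes "c \<in> carrier (cocycle_group n T)" "c' \<in> carrier (cocycle_group n T)"
  shows "cohomology_class n T c \<otimes>\<^bsub>cohomology_group n T\<^esub> cohomology_class n T c' =
    cohomology_class n T (\<lambda>s. c s + c' s)"
  using normal.rcos_sum[OF normal_coboundary_set assms]
  by (simp add: cohomology_group_def cohomology_class_def mult_cocycle_group)

lemma mem_cohomology_class:
  "x \<in> cohomology_class n T c \<longleftrightarrow> (\<lambda>s. x s + c s) \<in> coboundary_set n T"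
proof -
  have "x = (\<lambda>s. y s + c s) \<longleftrightarrow> y = (\<lambda>s. x s + c s)" for y
    by (auto simp: add.assoc)
  then show ?thesis
    by (auto simp: cohomology_class_def r_coset_def mult_cocycle_group)
qed

lemma cohomology_class_eq_iff:
  assumes "c \<in> carrier (cocycle_group n T)" "c' \<in> carrier (cocycle_group n T)"
  shows "cohomology_class n T c = cohomology_class n T c' \<longleftrightarrow>
    (\<lambda>s. c s + c' s) \<in> coboundary_set n T"
proof -
  interpret comm_group "cocycle_group n T"
    by (rule comm_group_cocycle_group)
  have "cohomology_class n T c = cohomology_class n T c' \<longleftrightarrow> c \<in> cohomology_class n T c'"
    using assms repr_independence[of c "coboundary_set n T" c'] rcos_self[of c "coboundary_set n T"]
    by (auto simp: cohomology_class_def subgroup_coboundary_set)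
  then show ?thesis
    by (simp add: mem_cohomology_class)
qed


section \<open>Functoriality\<close>

lemma cochain_map_in_cochain_group: "cochain_map n T f c \<in> carrier (cochain_group n T)"
  by (auto simp: cochain_map_def mem_cochain_group)

lemma cochain_map_add:
  "cochain_map n T f (\<lambda>s. c s + c' s) = (\<lambda>s. cochain_map n T f c s + cochain_map n T f c' s)"
  by (auto simp: cochain_map_def)

lemma cochain_map_zero: "cochain_map n T f (\<lambda>_. 0) = (\<lambda>_. 0)"
  by (auto simp: cochain_map_def)

lemma singular_face_of_simplex_map:
  assumes "k \<le> Suc n"
  shows "singular_face (Suc n) k (simplex_map (Suc n) f s) =
    simplex_map n f (singular_face (Suc n) k s)"
  using assms by (simp add: singular_face_simplex_map) (auto simp: simplex_map_def singular_face_def)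

lemma cochain_map_coboundary:
  assumes "continuous_map T T' f"
  shows "cochain_map (Suc n) T f (coboundary n T' c) = coboundary n T (cochain_map n T f c)"
proof (rule ext)
  fix s
  show "cochain_map (Suc n) T f (coboundary n T' c) s = coboundary n T (cochain_map n T f c) s"
  proof (cases "singular_simplex (Suc n) T s")
    case True
    then have "singular_simplex n T (singular_face (Suc n) k s)" if "k \<le> Suc n" for k
      using singular_simplex_singular_face[OF True _ that] by simp
    then show ?thesis
      using True singular_simplex_simplex_map[OF True assms]
      by (auto simp: cochain_map_def coboundary_def singular_face_of_simplex_map
          simp del: sum.atMost_Suc intro!: sum.cong)
  qed (simp add: cochain_map_def coboundary_def)
qed

lemma cochain_map_cocycle:
  assumes "continuous_map T T' f" "c \<in> carrier (cocycle_group n T')"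
  shows "cochain_map n T f c \<in> carrier (cocycle_group n T)"
  using assms cochain_map_coboundary[OF assms(1), of n c]
  by (simp add: mem_cocycle_group cochain_map_in_cochain_group cochain_map_zero)

lemma cochain_map_coboundary_set:
  assumes "continuous_map T T' f" "x \<in> coboundary_set n T'"
  shows "cochain_map n T f x \<in> coboundary_set n T"
proof (cases n)
  case 0
  with assms show ?thesis
    by (simp add: mem_coboundary_set_0 cochain_map_zero)
next
  case (Suc l)
  with assms obtain b where "x = coboundary l T' b"
    by (auto simp: mem_coboundary_set_Suc)
  with assms Suc show ?thesis
    by (auto simp: mem_coboundary_set_Suc cochain_map_coboundary cochain_map_in_cochain_group)
qed

lemma simplex_map_comp_on:
  assumes "singular_simplex n T s" and "\<And>x. x \<in> topspace T \<Longrightarrow> h x = g (f x)"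
  shows "simplex_map n h s = simplex_map n g (simplex_map n f s)"
  using simplex_map_eq[OF assms(1), of h "g \<circ> f"] assms(2) by (simp add: simplex_map_compose)

lemma cochain_map_comp_on:
  assumes "continuous_map T T' f" and "\<And>x. x \<in> topspace T \<Longrightarrow> h x = g (f x)"
  shows "cochain_map n T f (cochain_map n T' g c) = cochain_map n T h c"
proof
  fix s
  show "cochain_map n T f (cochain_map n T' g c) s = cochain_map n T h c s"
    using assms simplex_map_comp_on[of n T s h g f]
    by (simp add: cochain_map_def singular_simplex_simplex_map)
qed

lemma cohomology_map_class:
  assumes f: "continuous_map T T' f" and c: "c \<in> carrier (cocycle_group n T')"
  shows "cohomology_map n T f (cohomology_class n T' c) = cohomology_class n T (cochain_map n T f c)"
proof -
  have "cohomology_class n T (cochain_map n T f x) = cohomology_class n T (cochain_map n T f c)"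
    if "x \<in> cohomology_class n T' c" for x
  proof -
    have "x \<in> carrier (cocycle_group n T')"
      using that c subgroup.elemrcos_carrier[OF subgroup_coboundary_set] comm_group_cocycle_group
      by (fastforce simp: cohomology_class_def comm_group_def)
    moreover have "cochain_map n T f (\<lambda>s. x s + c s) \<in> coboundary_set n T"
      using that f by (simp add: mem_cohomology_class cochain_map_coboundary_set)
    ultimately show ?thesis
      using f c by (simp add: cohomology_class_eq_iff cochain_map_cocycle cochain_map_add)
  qed
  moreover have "c \<in> cohomology_class n T' c"
    using subgroup.one_closed[OF subgroup_coboundary_set[of n T']]
    by (simp add: mem_cohomology_class one_cocycle_group)
  ultimately show ?thesis
    unfolding cohomology_map_def cohomology_class_def[symmetric] by blast
qed

lemma cohomology_map_hom:
  assumes "continuous_map T T' f"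
  shows "cohomology_map n T f \<in> hom (cohomology_group n T') (cohomology_group n T)"
proof (rule homI)
  note cocycles = assms cochain_map_cocycle[OF assms] cocycle_add
  fix x assume "x \<in> carrier (cohomology_group n T')"
  then obtain c where c: "x = cohomology_class n T' c" "c \<in> carrier (cocycle_group n T')"
    by (auto simp: carrier_cohomology_group)
  then show "cohomology_map n T f x \<in> carrier (cohomology_group n T)"
    by (auto simp: cocycles cohomology_map_class carrier_cohomology_group)
  fix y assume "y \<in> carrier (cohomology_group n T')"
  then obtain c' where "y = cohomology_class n T' c'" "c' \<in> carrier (cocycle_group n T')"
    by (auto simp: carrier_cohomology_group)
  with c show "cohomology_map n T f (x \<otimes>\<^bsub>cohomology_group n T'\<^esub> y) =
      cohomology_map n T f x \<otimes>\<^bsub>cohomology_group n T\<^esub> cohomology_map n T f y"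
    by (simp add: cocycles cohomology_map_class mult_cohomology_class cochain_map_add)
qed

lemma simplex_map_inject:
  assumes "inj_on f (topspace T)" "singular_simplex n T s" "singular_simplex n T s'"
    and "simplex_map n f s = simplex_map n f s'"
  shows "s = s'"
proof (rule extensionalityI)
  show "s \<in> extensional (standard_simplex n)" "s' \<in> extensional (standard_simplex n)"
    using assms by (auto simp: singular_simplex_def)
  fix x assume x: "x \<in> standard_simplex n"
  then have "f (s x) = f (s' x)"
    using fun_cong[OF assms(4), of x] by (simp add: simplex_map_def)
  moreover have "s x \<in> topspace T" "s' x \<in> topspace T"
    using assms x by (auto simp: singular_simplex_def continuous_map_def)
  ultimately show "s x = s' x"
    using assms(1) by (simp add: inj_on_eq_iff)
qed

text \<open>Singular cochains are arbitrary functions on simplices, so along an injection they extend by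
  zero.\<close>

lemma cochain_extension:
  assumes f: "continuous_map T T' f" "inj_on f (topspace T)" and b: "b \<in> carrier (cochain_group n T)"
  obtains b' where "b' \<in> carrier (cochain_group n T')" "cochain_map n T f b' = b"
proof -
  define P where "P s' s \<longleftrightarrow> singular_simplex n T s \<and> s' = simplex_map n f s" for s' s
  define b' where "b' s' = (if Ex (P s') then b (SOME s. P s' s) else 0)" for s'
  have some: "(SOME t. P (simplex_map n f s) t) = s" if "singular_simplex n T s" for s
    using that simplex_map_inject[OF f(2)] by (intro some_equality) (auto simp: P_def)
  have "b' (simplex_map n f s) = b s" if "singular_simplex n T s" for s
  proof -
    have "P (simplex_map n f s) s"
      using that by (simp add: P_def)
    with that some show ?thesis
      by (auto simp: b'_def)
  qed
  then have "cochain_map n T f b' = b"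
    using b by (auto simp: cochain_map_def mem_cochain_group fun_eq_iff)
  moreover have "b' \<in> carrier (cochain_group n T')"
    using singular_simplex_simplex_map[OF _ f(1)] by (auto simp: mem_cochain_group b'_def P_def)
  ultimately show ?thesis
    using that by blast
qed

lemma coboundary_set_extension:
  assumes f: "continuous_map T T' f" "inj_on f (topspace T)" and x: "x \<in> coboundary_set n T"
  obtains x' where "x' \<in> coboundary_set n T'" "cochain_map n T f x' = x"
proof (cases n)
  case 0
  then show ?thesis
    using x that[of "\<lambda>_. 0"] by (auto simp: mem_coboundary_set_0 cochain_map_zero)
next
  case (Suc l)
  then obtain b where "b \<in> carrier (cochain_group l T)" "x = coboundary l T b"
    using x by (auto simp: mem_coboundary_set_Suc)
  moreover obtain b' where "b' \<in> carrier (cochain_group l T')" "cochain_map l T f b' = b"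
    using cochain_extension[OF f] calculation(1) .
  ultimately show ?thesis
    using that[of "coboundary l T' b'"] f Suc
    by (auto simp: mem_coboundary_set_Suc cochain_map_coboundary)
qed


section \<open>Cohomology of a sequential union\<close>

text \<open>Cohomology only sees singular simplices, so the relation between the union and its stages is
  stated for simplices. For a set \<open>X\<close> that is not locally compact, the product with an infinite
  Stiefel manifold may carry a coarser topology than the direct limit of the products with the
  finite ones, but its simplices are the same.\<close>

locale singular_union =
  fixes T :: "nat \<Rightarrow> 'a topology" and j :: "nat \<Rightarrow> 'a \<Rightarrow> 'a"
    and B :: "'b topology" and \<iota> :: "nat \<Rightarrow> 'a \<Rightarrow> 'b"
  assumes continuous_j: "continuous_map (T k) (T (Suc k)) (j k)"
    and continuous_\<iota>: "continuous_map (T k) B (\<iota> k)"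
    and inj_\<iota>: "inj_on (\<iota> k) (topspace (T k))"
    and \<iota>_j: "x \<in> topspace (T k) \<Longrightarrow> \<iota> (Suc k) (j k x) = \<iota> k x"
    and simplex_lift: "singular_simplex n B s \<Longrightarrow>
      \<exists>k t. singular_simplex n (T k) t \<and> s = simplex_map n (\<iota> k) t"
begin

lemma inj_j: "inj_on (j k) (topspace (T k))"
  by (metis \<iota>_j inj_\<iota> inj_on_def)

lemma cochain_map_j_\<iota>:
  "cochain_map n (T k) (j k) (cochain_map n (T (Suc k)) (\<iota> (Suc k)) c) = cochain_map n (T k) (\<iota> k) c"
  using continuous_j by (rule cochain_map_comp_on) (simp add: \<iota>_j)

lemma simplex_map_j_\<iota>:
  assumes "singular_simplex n (T k) s"
  shows "simplex_map n (\<iota> (Suc k)) (simplex_map n (j k) s) = simplex_map n (\<iota> k) s"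
  using simplex_map_comp_on[OF assms, of "\<iota> k" "\<iota> (Suc k)" "j k"] \<iota>_j by simp

lemma cochain_eqI:
  assumes "c \<in> carrier (cochain_group n B)" "c' \<in> carrier (cochain_group n B)"
    and eq: "\<And>k. cochain_map n (T k) (\<iota> k) c = cochain_map n (T k) (\<iota> k) c'"
  shows "c = c'"
proof (rule ext)
  fix s
  show "c s = c' s"
  proof (cases "singular_simplex n B s")
    case True
    then obtain k t where "singular_simplex n (T k) t" "s = simplex_map n (\<iota> k) t"
      using simplex_lift by blast
    then show ?thesis
      using fun_cong[OF eq[of k], of t] by (simp add: cochain_map_def)
  qed (use assms in \<open>auto simp: mem_cochain_group\<close>)
qed

lemma cochain_glue:
  assumes c: "\<And>k. c k \<in> carrier (cochain_group n (T k))"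
    and j: "\<And>k. cochain_map n (T k) (j k) (c (Suc k)) = c k"
  obtains c' where "c' \<in> carrier (cochain_group n B)" "\<And>k. cochain_map n (T k) (\<iota> k) c' = c k"
proof -
  (* The stages prescribe values on their own simplices; as the stages are nested, two of them
     prescribe the same value wherever both do. *)
  define P where "P s k v \<longleftrightarrow> (\<exists>t. singular_simplex n (T k) t \<and> s = simplex_map n (\<iota> k) t \<and> v = c k t)"
    for s k v
  have P_Suc: "P s (Suc k) v" if Pk: "P s k v" for s k v
  proof -
    obtain t where t: "singular_simplex n (T k) t" "s = simplex_map n (\<iota> k) t" "v = c k t"
      using Pk by (auto simp: P_def)
    have "c k t = c (Suc k) (simplex_map n (j k) t)"
      using fun_cong[OF j[of k], of t] t(1) by (simp add: cochain_map_def)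
    then show ?thesis
      unfolding P_def using t continuous_j
      by (intro exI[of _ "simplex_map n (j k) t"]) (simp add: singular_simplex_simplex_map simplex_map_j_\<iota>)
  qed
  have P_le: "P s l v" if "P s k v" "k \<le> l" for s k l v
    using that(2,1) by (induction rule: dec_induct) (auto intro: P_Suc)
  have P_same: "v = v'" if "P s k v" "P s k v'" for s k v v'
    using that simplex_map_inject[OF inj_\<iota>] by (metis P_def)
  have P_unique: "v = v'" if "P s k v" "P s l v'" for s k l v v'
    using P_le[OF that(1), of "max k l"] P_le[OF that(2), of "max k l"] P_same by simp
  define c' where "c' s = (if \<exists>k v. P s k v then SOME v. \<exists>k. P s k v else 0)" for s
  have c': "c' s = v" if "P s k v" for s k v
  proof -
    have "(SOME v. \<exists>k. P s k v) = v"
      using that P_unique by (intro some_equality) blast+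
    with that show ?thesis
      by (auto simp: c'_def)
  qed
  have "cochain_map n (T k) (\<iota> k) c' = c k" for k
  proof
    fix t
    show "cochain_map n (T k) (\<iota> k) c' t = c k t"
    proof (cases "singular_simplex n (T k) t")
      case True
      then have "P (simplex_map n (\<iota> k) t) k (c k t)"
        by (auto simp: P_def)
      with True c' show ?thesis
        by (simp add: cochain_map_def)
    qed (use c in \<open>auto simp: cochain_map_def mem_cochain_group\<close>)
  qed
  moreover have "c' s = 0" if "\<not> singular_simplex n B s" for s
  proof -
    have "\<not> P s k v" for k v
      using that singular_simplex_simplex_map[OF _ continuous_\<iota>] by (auto simp: P_def)
    then show ?thesis by (simp add: c'_def)
  qed
  ultimately show ?thesis
    using that by (auto simp: mem_cochain_group)
qed

text \<open>Mittag-Leffler: a compatible sequence of classes has a compatible sequence of representing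
  cocycles, because the coboundary by which a representative misses the previous one extends by
  zero to the next space and can be added there.\<close>

lemma compatible_classes_from_union:
  assumes a: "\<And>k. a k \<in> carrier (cohomology_group n (T k))"
    and j: "\<And>k. cohomology_map n (T k) (j k) (a (Suc k)) = a k"
  obtains c where "c \<in> carrier (cocycle_group n B)"
    "\<And>k. cohomology_map n (T k) (\<iota> k) (cohomology_class n B c) = a k"
proof -
  let ?Z = "\<lambda>k. carrier (cocycle_group n (T k))"
  have sub: "coboundary_set n (T k) \<subseteq> ?Z k" for k
    using subgroup_coboundary_set by (rule subgroup.subset)
  have "\<exists>c. \<forall>k. (c k \<in> ?Z k \<and> cohomology_class n (T k) (c k) = a k) \<and>
      cochain_map n (T k) (j k) (c (Suc k)) = c k"
  proof (rule dependent_nat_choice)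
    show "\<exists>x. x \<in> ?Z 0 \<and> cohomology_class n (T 0) x = a 0"
      using a[of 0] by (auto simp: carrier_cohomology_group)
  next
    fix x k assume x: "x \<in> ?Z k \<and> cohomology_class n (T k) x = a k"
    obtain y where y: "y \<in> ?Z (Suc k)" "cohomology_class n (T (Suc k)) y = a (Suc k)"
      using a[of "Suc k"] by (auto simp: carrier_cohomology_group)
    have "cohomology_class n (T k) (cochain_map n (T k) (j k) y) = cohomology_class n (T k) x"
      using cohomology_map_class[OF continuous_j y(1)] y(2) j[of k] x by simp
    then have "(\<lambda>s. cochain_map n (T k) (j k) y s + x s) \<in> coboundary_set n (T k)"
      using x cohomology_class_eq_iff[OF cochain_map_cocycle[OF continuous_j y(1)], of x] by simp
    then obtain w where w: "w \<in> coboundary_set n (T (Suc k))"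
      "cochain_map n (T k) (j k) w = (\<lambda>s. cochain_map n (T k) (j k) y s + x s)"
      using coboundary_set_extension[OF continuous_j inj_j] by blast
    have z: "(\<lambda>s. y s + w s) \<in> ?Z (Suc k)"
      using cocycle_add y(1) w(1) sub by blast
    have "(\<lambda>s. (y s + w s) + y s) = w"
      by (simp add: add.assoc add.commute add.left_commute)
    then have "cohomology_class n (T (Suc k)) (\<lambda>s. y s + w s) = a (Suc k)"
      using y z w by (simp add: cohomology_class_eq_iff flip: y(2))
    moreover have "cochain_map n (T k) (j k) (\<lambda>s. y s + w s) = x"
      by (simp add: cochain_map_add w(2) flip: add.assoc)
    ultimately show "\<exists>z. (z \<in> ?Z (Suc k) \<and> cohomology_class n (T (Suc k)) z = a (Suc k)) \<and>
        cochain_map n (T k) (j k) z = x"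
      using z by blast
  qed
  then obtain c where c: "\<And>k. c k \<in> ?Z k" "\<And>k. cohomology_class n (T k) (c k) = a k"
    "\<And>k. cochain_map n (T k) (j k) (c (Suc k)) = c k"
    by blast
  have "c k \<in> carrier (cochain_group n (T k))" for k
    using c(1) by (simp add: mem_cocycle_group)
  then obtain c' where c': "c' \<in> carrier (cochain_group n B)" "\<And>k. cochain_map n (T k) (\<iota> k) c' = c k"
    using cochain_glue[OF _ c(3)] by blast
  have "coboundary n B c' = (\<lambda>_. 0)"
  proof (rule cochain_eqI)
    fix k
    show "cochain_map (Suc n) (T k) (\<iota> k) (coboundary n B c') = cochain_map (Suc n) (T k) (\<iota> k) (\<lambda>_. 0)"
      using c(1)[of k] continuous_\<iota> by (simp add: cochain_map_coboundary c'(2) cochain_map_zero mem_cocycle_group)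
  qed (rule coboundary_in_cochain_group, rule zero_in_cochain_group)
  then have z: "c' \<in> carrier (cocycle_group n B)"
    using c' by (simp add: mem_cocycle_group)
  moreover have "cohomology_map n (T k) (\<iota> k) (cohomology_class n B c') = a k" for k
    using cohomology_map_class[OF continuous_\<iota> z] by (simp add: c' c)
  ultimately show ?thesis
    using that by blast
qed

text \<open>The obstruction to injectivity, the derived limit of the cohomology in the previous degree,
  vanishes because the coefficients are finite. The primitives on the \<open>k\<close>-th space form a closed
  non-empty subset of the compact space of all \<open>{0, 1}\<close>-valued functions on the simplices of the
  union, and these subsets decrease with \<open>k\<close>; a common point is a primitive on the union.\<close>

lemma coboundary_if_locally_coboundary:
  assumes c: "c \<in> carrier (cochain_group n B)"
    and loc: "\<And>k. cochain_map n (T k) (\<iota> k) c \<in> coboundary_set n (T k)"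
  shows "c \<in> coboundary_set n B"
proof (cases n)
  case 0
  then have "c = (\<lambda>_. 0)"
    using loc by (intro cochain_eqI[OF c]) (auto simp: mem_coboundary_set_0 cochain_map_zero mem_cochain_group)
  then show ?thesis
    by (simp add: 0 mem_coboundary_set_0)
next
  case (Suc l)
  let ?D = "\<lambda>b s. \<Sum>i\<le>n. b (singular_face n i s) :: bit"
  define S where "S k = simplex_map n (\<iota> k) ` Collect (singular_simplex n (T k))" for k
  have S_B: "singular_simplex n B s" if "s \<in> S k" for s k
    using that continuous_\<iota> by (auto simp: S_def singular_simplex_simplex_map)
  define C where "C k = {b. \<forall>s\<in>S k. ?D b s = c s}" for k
  define \<T> where "\<T> = product_topology (\<lambda>_::(nat \<Rightarrow> real) \<Rightarrow> 'b. discrete_topology (UNIV :: bit set)) UNIV"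
  have finite_bit: "finite (UNIV :: bit set)"
  proof (rule finite_subset)
    show "(UNIV :: bit set) \<subseteq> {0, 1}" by auto
  qed simp
  have "compact_space \<T>"
    unfolding \<T>_def by (simp add: compact_space_product_topology compact_space_discrete_topology finite_bit)
  moreover have "closedin \<T> (C k)" for k
  proof -
    have eval: "continuous_map \<T> (discrete_topology UNIV) (\<lambda>b. b s)" for s
      unfolding \<T>_def by (rule continuous_map_product_projection) simp
    have add: "continuous_map \<T> (discrete_topology UNIV) (\<lambda>b. f b + g b :: bit)"
      if "continuous_map \<T> (discrete_topology UNIV) f" "continuous_map \<T> (discrete_topology UNIV) g" for f g
    proof -
      have "continuous_map (prod_topology (discrete_topology UNIV) (discrete_topology UNIV))
          (discrete_topology UNIV) (\<lambda>(x, y). x + y :: bit)"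
        by (simp flip: prod_topology_discrete_topology)
      from continuous_map_compose[OF continuous_map_pairedI[OF that] this] show ?thesis
        by (simp add: o_def)
    qed
    have "continuous_map \<T> (discrete_topology UNIV) (\<lambda>b. \<Sum>i\<in>I. b (singular_face n i s) :: bit)"
      if "finite I" for I s
      using that by (induction I) (auto intro: add eval)
    then have "closedin \<T> {b \<in> topspace \<T>. ?D b s \<in> {c s}}" for s
      by (rule closedin_continuous_map_preimage) auto
    then have "closedin \<T> (\<Inter>(insert (topspace \<T>) ((\<lambda>s. {b \<in> topspace \<T>. ?D b s \<in> {c s}}) ` S k)))"
      by (intro closedin_Inter) auto
    also have "\<Inter>(insert (topspace \<T>) ((\<lambda>s. {b \<in> topspace \<T>. ?D b s \<in> {c s}}) ` S k)) = C k"
      by (auto simp: C_def \<T>_def)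
    finally show ?thesis .
  qed
  moreover have "C k \<noteq> {}" for k
  proof -
    obtain b where b: "b \<in> carrier (cochain_group l (T k))"
      "cochain_map n (T k) (\<iota> k) c = coboundary l (T k) b"
      using loc[of k] by (auto simp: Suc mem_coboundary_set_Suc)
    obtain b' where b': "b' \<in> carrier (cochain_group l B)" "cochain_map l (T k) (\<iota> k) b' = b"
      using cochain_extension[OF continuous_\<iota> inj_\<iota> b(1)] .
    have eq: "cochain_map n (T k) (\<iota> k) c = cochain_map n (T k) (\<iota> k) (coboundary l B b')"
      using continuous_\<iota> b(2) by (simp add: b' Suc cochain_map_coboundary)
    have "?D b' s = c s" if "s \<in> S k" for s
    proof -
      obtain t where t: "singular_simplex n (T k) t" "s = simplex_map n (\<iota> k) t"
        using \<open>s \<in> S k\<close> by (auto simp: S_def)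
      have "c s = coboundary l B b' s"
        using fun_cong[OF eq, of t] t by (simp add: cochain_map_def)
      then show ?thesis
        using S_B[OF that] by (simp add: coboundary_def Suc del: sum.atMost_Suc)
    qed
    then show ?thesis
      by (auto simp: C_def)
  qed
  moreover have "decseq C"
  proof -
    have "S k \<subseteq> S (Suc k)" for k
    proof
      fix s assume "s \<in> S k"
      then obtain t where t: "singular_simplex n (T k) t" "s = simplex_map n (\<iota> k) t"
        by (auto simp: S_def)
      then show "s \<in> S (Suc k)"
        unfolding S_def using continuous_j
        by (intro image_eqI[of _ _ "simplex_map n (j k) t"])
           (simp_all add: simplex_map_j_\<iota> singular_simplex_simplex_map)
    qed
    then show ?thesis
      unfolding decseq_Suc_iff C_def by blast
  qed
  ultimately have "(\<Inter>k. C k) \<noteq> {}"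
    by (rule compact_space_imp_nest)
  then obtain b where b: "\<And>k. b \<in> C k"
    by blast
  (* A point of the product may be non-zero off the singular simplices; a cochain may not. *)
  define b' where "b' s = (if singular_simplex l B s then b s else 0)" for s
  have "c = coboundary l B b'"
  proof
    fix s
    show "c s = coboundary l B b' s"
    proof (cases "singular_simplex n B s")
      case True
      then obtain k where "s \<in> S k"
        using simplex_lift[OF True] by (auto simp: S_def)
      then have "c s = ?D b s"
        using b by (auto simp: C_def)
      moreover have "singular_simplex l B (singular_face n i s)" if "i \<le> n" for i
        using singular_simplex_singular_face[OF True _ that] Suc by simp
      ultimately show ?thesis
        using True by (simp add: coboundary_def b'_def Suc del: sum.atMost_Suc)
    qed (use c Suc in \<open>auto simp: coboundary_def mem_cochain_group\<close>)
  qed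
  moreover have "b' \<in> carrier (cochain_group l B)"
    by (simp add: b'_def mem_cochain_group)
  ultimately show ?thesis
    by (auto simp: Suc mem_coboundary_set_Suc)
qed

theorem cohomology_iso_inverse_limit:
  "(\<lambda>a. \<lambda>k. cohomology_map n (T k) (\<iota> k) a)
     \<in> iso (cohomology_group n B)
           (inverse_limit_group (\<lambda>k. cohomology_group n (T k)) (\<lambda>k. cohomology_map n (T k) (j k)))"
    (is "?h \<in> iso ?H ?L")
proof -
  have hom_\<iota>: "cohomology_map n (T k) (\<iota> k) \<in> hom ?H (cohomology_group n (T k))" for k
    using continuous_\<iota> by (rule cohomology_map_hom)
  have carrier_L: "a \<in> carrier ?L \<longleftrightarrow> (\<forall>k. a k \<in> carrier (cohomology_group n (T k))) \<and>
      (\<forall>k. cohomology_map n (T k) (j k) (a (Suc k)) = a k)" for a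
    by (auto simp: inverse_limit_group_def PiE_def)
  have hom: "?h \<in> hom ?H ?L"
  proof (rule homI)
    fix x assume x: "x \<in> carrier ?H"
    then obtain c where c: "x = cohomology_class n B c" "c \<in> carrier (cocycle_group n B)"
      by (auto simp: carrier_cohomology_group)
    have "cohomology_map n (T k) (j k) (?h x (Suc k)) = ?h x k" for k
      using c continuous_\<iota> cohomology_map_class[OF continuous_j cochain_map_cocycle[OF continuous_\<iota> c(2)]]
      by (simp add: cohomology_map_class cochain_map_j_\<iota>)
    then show "?h x \<in> carrier ?L"
      using hom_in_carrier[OF hom_\<iota> x] by (auto simp: carrier_L)
    fix y assume y: "y \<in> carrier ?H"
    have "?h (x \<otimes>\<^bsub>?H\<^esub> y) k = ?h x k \<otimes>\<^bsub>cohomology_group n (T k)\<^esub> ?h y k" for k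
      using hom_mult[OF hom_\<iota> x y] .
    then show "?h (x \<otimes>\<^bsub>?H\<^esub> y) = ?h x \<otimes>\<^bsub>?L\<^esub> ?h y"
      by (simp add: inverse_limit_group_def fun_eq_iff)
  qed
  have inj: "inj_on ?h (carrier ?H)"
  proof (rule inj_onI)
    fix x y assume "x \<in> carrier ?H" "y \<in> carrier ?H" and eq: "?h x = ?h y"
    then obtain c c' where c: "x = cohomology_class n B c" "c \<in> carrier (cocycle_group n B)"
      "y = cohomology_class n B c'" "c' \<in> carrier (cocycle_group n B)"
      by (auto simp: carrier_cohomology_group)
    have "cochain_map n (T k) (\<iota> k) (\<lambda>s. c s + c' s) \<in> coboundary_set n (T k)" for k
      using fun_cong[OF eq, of k] c continuous_\<iota>
        cohomology_class_eq_iff[OF cochain_map_cocycle[OF continuous_\<iota> c(2)] cochain_map_cocycle[OF continuous_\<iota> c(4)]]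
      by (simp add: cohomology_map_class cochain_map_add)
    then have "(\<lambda>s. c s + c' s) \<in> coboundary_set n B"
      using c by (intro coboundary_if_locally_coboundary) (auto simp: mem_cocycle_group mem_cochain_group)
    then show "x = y"
      using c by (simp add: cohomology_class_eq_iff)
  qed
  have "carrier ?L \<subseteq> ?h ` carrier ?H"
  proof
    fix a assume "a \<in> carrier ?L"
    then obtain c where "c \<in> carrier (cocycle_group n B)"
      "\<And>k. cohomology_map n (T k) (\<iota> k) (cohomology_class n B c) = a k"
      using compatible_classes_from_union[of a n] unfolding carrier_L by blast
    then show "a \<in> ?h ` carrier ?H"
      by (intro image_eqI[of _ _ "cohomology_class n B c"]) (auto simp: carrier_cohomology_group)
  qed
  then have "?h ` carrier ?H = carrier ?L"
    using hom by (auto simp: hom_def)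
  with hom inj show ?thesis
    by (simp add: iso_def bij_betw_def)
qed

end


section \<open>Invariant polynomials of a permutation action\<close>

lemma real_algebra_generated_sum:
  assumes "\<And>i. i \<in> I \<Longrightarrow> f i \<in> real_algebra_generated S"
  shows "(\<lambda>z. \<Sum>i\<in>I. f i z) \<in> real_algebra_generated S"
  using assms by (induction I rule: infinite_finite_induct)
    (simp_all add: real_algebra_generated.const real_algebra_generated.add)

lemma real_algebra_generated_prod:
  assumes "\<And>i. i \<in> I \<Longrightarrow> f i \<in> real_algebra_generated S"
  shows "(\<lambda>z. \<Prod>i\<in>I. f i z) \<in> real_algebra_generated S"
  using assms by (induction I rule: infinite_finite_induct)
    (simp_all add: real_algebra_generated.const real_algebra_generated.mult)

lemma real_algebra_generated_square_diff:
  assumes "f \<in> real_algebra_generated S"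
  shows "(\<lambda>z. (f z - c)\<^sup>2) \<in> real_algebra_generated S"
proof -
  have "(\<lambda>z. f z + (- c)) \<in> real_algebra_generated S"
    using assms by (intro real_algebra_generated.add real_algebra_generated.const)
  from real_algebra_generated.mult[OF this this] show ?thesis
    by (simp add: power2_eq_square)
qed

lemma real_algebra_generated_eq_at:
  assumes "f \<in> real_algebra_generated S" "\<And>h. h \<in> S \<Longrightarrow> h z = h w"
  shows "f z = f w"
  using assms(1) by induction (simp_all add: assms(2))

lemma coordinate_in_mixed_polynomials:
  "i < d \<Longrightarrow> (\<lambda>z. fst z i) \<in> mixed_polynomials d N k"
  "\<lbrakk>i < k; j < N\<rbrakk> \<Longrightarrow> (\<lambda>z. snd z (i, j)) \<in> mixed_polynomials d N k"
  unfolding mixed_polynomials_def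
  by (rule real_algebra_generated.gen; fastforce simp: case_prod_beta')+

lemma mixed_polynomial_continuous:
  assumes "f \<in> mixed_polynomials d N k"
  shows "continuous_on UNIV f"
  using assms unfolding mixed_polynomials_def
proof induction
  case (gen f)
  have "continuous_on UNIV (\<lambda>z::point. fst z i)" for i
    by (rule continuous_on_compose2[OF continuous_on_product_coordinates]) (auto intro: continuous_intros)
  moreover have "continuous_on UNIV (\<lambda>z::point. snd z i)" for i
    by (rule continuous_on_compose2[OF continuous_on_product_coordinates]) (auto intro: continuous_intros)
  ultimately show ?case
    using gen by (auto simp: case_prod_beta')
qed (simp_all add: continuous_on_add continuous_on_mult)

lemma mixed_polynomial_truncate:
  assumes "f \<in> mixed_polynomials d N k"
  shows "f (x, \<lambda>(i, j). if i < k then A (i, j) else 0) = f (x, A)"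
  using assms unfolding mixed_polynomials_def
  by (rule real_algebra_generated_eq_at) auto

lemma descend_eq:
  assumes "z \<in> S" "\<And>w. \<lbrakk>w \<in> S; q w = q z\<rbrakk> \<Longrightarrow> f w = f z"
  shows "descend S q f (q z) = f z"
  unfolding descend_def
proof (rule the_equality)
  show "\<exists>w\<in>S. q z = q w \<and> f z = f w"
    using assms(1) by blast
  show "y = f z" if "\<exists>w\<in>S. q z = q w \<and> y = f w" for y
    using that assms(2) by metis
qed

locale permutation_actions =
  fixes G :: "('g, 'b) monoid_scheme" and d N :: nat and \<sigma> \<tau> :: "'g \<Rightarrow> nat \<Rightarrow> nat"
  assumes group: "group G" and fin: "finite (carrier G)"
    and \<sigma>: "group_action G {..<d} \<sigma>" and \<tau>: "group_action G {..<N} \<tau>"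
begin

abbreviation act :: "'g \<Rightarrow> point \<Rightarrow> point" where
  "act \<equiv> diag_act G d N \<sigma> \<tau>"

text \<open>On this set the formulas for the diagonal action do define an action, for any number of rows of
  the matrices. Elsewhere they cut off coordinates, even for the neutral element.\<close>

definition points :: "point set" where
  "points = topspace (Euclidean_space d) \<times> {A. \<forall>i j. j \<ge> N \<longrightarrow> A (i, j) = 0}"

lemma \<sigma>_less: "\<lbrakk>g \<in> carrier G; i < d\<rbrakk> \<Longrightarrow> \<sigma> g i < d"
  using group_action.element_image[OF \<sigma>, of g i] by auto

lemma \<tau>_less: "\<lbrakk>g \<in> carrier G; i < N\<rbrakk> \<Longrightarrow> \<tau> g i < N"
  using group_action.element_image[OF \<tau>, of g i] by auto

lemma act_apply:
  assumes "g \<in> carrier G"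
  shows "act g z = (\<lambda>i. if i < d then fst z (\<sigma> (inv\<^bsub>G\<^esub> g) i) else 0,
    \<lambda>(i, j). if j < N then snd z (i, \<tau> (inv\<^bsub>G\<^esub> g) j) else 0)"
proof -
  have "(\<Sum>l<N. A (i, l) * perm_matrix \<tau> (inv\<^bsub>G\<^esub> g) (l, j)) = A (i, \<tau> (inv\<^bsub>G\<^esub> g) j)"
    if "j < N" for A :: "nat \<times> nat \<Rightarrow> real" and i j
  proof -
    have "\<tau> (inv\<^bsub>G\<^esub> g) j < N"
      using assms that group by (simp add: \<tau>_less group.inv_closed)
    then show ?thesis
      by (simp add: perm_matrix_def if_distrib sum.delta cong: if_cong)
  qed
  then show ?thesis
    by (auto simp: diag_act_def coord_act_def stiefel_act_def case_prod_beta fun_eq_iff)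
qed

lemma act_one:
  assumes "z \<in> points"
  shows "act \<one>\<^bsub>G\<^esub> z = z"
proof -
  interpret group G by (rule group)
  show ?thesis
    using assms group_action.id_eq_one[OF \<sigma>, symmetric] group_action.id_eq_one[OF \<tau>, symmetric]
    by (cases z) (auto simp: act_apply points_def topspace_Euclidean_space fun_eq_iff)
qed

lemma act_mult:
  assumes "g \<in> carrier G" "h \<in> carrier G"
  shows "act (g \<otimes>\<^bsub>G\<^esub> h) z = act g (act h z)"
proof -
  interpret group G by (rule group)
  show ?thesis
    using assms by (auto simp: act_apply inv_mult_group fun_eq_iff \<sigma>_less \<tau>_less
        group_action.composition_rule[OF \<sigma>] group_action.composition_rule[OF \<tau>])
qed

lemma mem_orbit_self:
  assumes "w \<in> points"
  shows "w \<in> orbit G act w"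
  using act_one[OF assms] group.is_monoid[OF group, THEN monoid.one_closed]
  unfolding orbit_def by (metis (mono_tags, lifting) mem_Collect_eq)

lemma act_mem_orbit:
  assumes "g \<in> carrier G" "u \<in> orbit G act z"
  shows "act g u \<in> orbit G act z"
proof -
  interpret group G by (rule group)
  obtain h where "h \<in> carrier G" "u = act h z"
    using assms(2) by (auto simp: orbit_def)
  then have "act g u = act (g \<otimes>\<^bsub>G\<^esub> h) z" "g \<otimes>\<^bsub>G\<^esub> h \<in> carrier G"
    using assms(1) by (simp_all add: act_mult)
  then show ?thesis
    unfolding orbit_def by blast
qed

lemma orbit_eq_iff:
  assumes "z \<in> points" "w \<in> points"
  shows "orbit G act z = orbit G act w \<longleftrightarrow> (\<exists>g\<in>carrier G. w = act g z)"
proof -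
  interpret group G by (rule group)
  have translate: "orbit G act z = orbit G act (act g z)" if g: "g \<in> carrier G" for g
  proof (intro equalityI subsetI)
    fix u assume "u \<in> orbit G act z"
    then obtain h where "h \<in> carrier G" "u = act h z"
      by (auto simp: orbit_def)
    then have "u = act (h \<otimes>\<^bsub>G\<^esub> inv\<^bsub>G\<^esub> g) (act g z)" "h \<otimes>\<^bsub>G\<^esub> inv\<^bsub>G\<^esub> g \<in> carrier G"
      using g by (simp_all add: m_assoc flip: act_mult)
    then show "u \<in> orbit G act (act g z)"
      unfolding orbit_def by blast
  next
    fix u assume "u \<in> orbit G act (act g z)"
    moreover have "act g z \<in> orbit G act z"
      using g unfolding orbit_def by blast
    ultimately show "u \<in> orbit G act z"
      unfolding orbit_def[of _ _ "act g z"] using act_mem_orbit by blast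
  qed
  show ?thesis
  proof
    assume "orbit G act z = orbit G act w"
    with mem_orbit_self[OF assms(2)] show "\<exists>g\<in>carrier G. w = act g z"
      by (auto simp: orbit_def)
  next
    assume "\<exists>g\<in>carrier G. w = act g z"
    with translate show "orbit G act z = orbit G act w"
      by blast
  qed
qed

lemma act_stiefel_set:
  assumes g: "g \<in> carrier G" and z: "snd z \<in> stiefel_set N k"
  shows "snd (act g z) \<in> stiefel_set N k"
proof -
  interpret group G by (rule group)
  have "\<tau> (inv\<^bsub>G\<^esub> g) a = \<tau> (inv\<^bsub>G\<^esub> g) b \<longleftrightarrow> a = b" if "a < N" "b < N" for a b
    using group_action.inj_prop[OF \<tau>, of "inv\<^bsub>G\<^esub> g"] that g by (auto simp: inj_on_def)
  then show ?thesis
    using z g by (auto simp: act_apply stiefel_set_def matrices_def \<tau>_less)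
qed

text \<open>An invariant polynomial in the first \<open>k\<close> rows is invariant as a function of infinite matrices,
  because the action permutes columns only.\<close>

lemma invariant_polynomial_act:
  assumes f: "f \<in> invariant_polynomials G d N \<sigma> \<tau> k" and g: "g \<in> carrier G" and z: "z \<in> points"
  shows "f (act g z) = f z"
proof -
  obtain x A where xA: "z = (x, A)"
    by (cases z)
  let ?t = "\<lambda>A (i, j). if i < k then A (i, j) else 0 :: real"
  have mixed: "f \<in> mixed_polynomials d N k"
    using f by (simp add: invariant_polynomials_def)
  have "act g (x, ?t A) = (fst (act g z), ?t (snd (act g z)))"
    using g by (auto simp: act_apply xA fun_eq_iff)
  moreover have "(x, ?t A) \<in> topspace (Euclidean_space d) \<times> matrices k N"
    using z by (auto simp: xA points_def matrices_def)
  then have "f (act g (x, ?t A)) = f (x, ?t A)"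
    using f g by (auto simp: invariant_polynomials_def)
  ultimately have "f (fst (act g z), ?t (snd (act g z))) = f (x, ?t A)"
    by simp
  then show ?thesis
    by (simp add: mixed_polynomial_truncate[OF mixed] xA)
qed

text \<open>The product of the squared distances from \<open>z\<close> to the translates of a variable point is an
  invariant polynomial whose zero set is the orbit of \<open>z\<close>.\<close>

lemma orbit_separating_polynomial:
  assumes z: "z \<in> topspace (Euclidean_space d) \<times> matrices k N"
  obtains F where "F \<in> invariant_polynomials G d N \<sigma> \<tau> k" "F z = 0"
    "\<And>w. \<lbrakk>w \<in> topspace (Euclidean_space d) \<times> matrices k N; F w = 0\<rbrakk> \<Longrightarrow> \<exists>g\<in>carrier G. z = act g w"
proof -
  interpret group G by (rule group)
  have points: "w \<in> points" if "w \<in> topspace (Euclidean_space d) \<times> matrices k N" for w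
    using that by (auto simp: points_def matrices_def)
  define D where "D w = (\<Sum>i<d. (fst w i - fst z i)\<^sup>2) + (\<Sum>i<k. \<Sum>j<N. (snd w (i, j) - snd z (i, j))\<^sup>2)"
    for w :: point
  define F where "F w = (\<Prod>g\<in>carrier G. D (act g w))" for w
  have D_eq_0: "D w = 0 \<longleftrightarrow> w = z" if "w \<in> topspace (Euclidean_space d) \<times> matrices k N" for w
  proof
    assume D0: "D w = 0"
    moreover have "(\<Sum>i<d. (fst w i - fst z i)\<^sup>2) \<ge> 0"
      "(\<Sum>i<k. \<Sum>j<N. (snd w (i, j) - snd z (i, j))\<^sup>2) \<ge> 0"
      by (simp_all add: sum_nonneg)
    ultimately have 0: "(\<Sum>i<d. (fst w i - fst z i)\<^sup>2) = 0"
      "(\<Sum>i<k. \<Sum>j<N. (snd w (i, j) - snd z (i, j))\<^sup>2) = 0"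
      unfolding D_def by linarith+
    have "fst w i = fst z i" for i
      using 0(1) that z by (cases "i < d") (auto simp: sum_nonneg_eq_0_iff topspace_Euclidean_space)
    moreover have "snd w (i, j) = snd z (i, j)" for i j
      using 0(2) that z
      by (cases "i < k \<and> j < N") (auto simp: sum_nonneg_eq_0_iff sum_nonneg matrices_def)
    ultimately show "w = z"
      by (auto simp: prod_eq_iff fun_eq_iff)
  qed (simp add: D_def)
  have act_mem: "act g w \<in> topspace (Euclidean_space d) \<times> matrices k N"
    if "g \<in> carrier G" "w \<in> topspace (Euclidean_space d) \<times> matrices k N" for g w
    using that by (auto simp: act_apply topspace_Euclidean_space matrices_def)
  have "(\<lambda>w. D (act g w)) \<in> mixed_polynomials d N k" if g: "g \<in> carrier G" for g
  proof -
    have "(\<lambda>w. fst (act g w) i) \<in> mixed_polynomials d N k" if "i < d" for i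
      using that g coordinate_in_mixed_polynomials(1)[of "\<sigma> (inv\<^bsub>G\<^esub> g) i" d N k] \<sigma>_less
      by (simp add: act_apply)
    moreover have "(\<lambda>w. snd (act g w) (i, j)) \<in> mixed_polynomials d N k" if "i < k" "j < N" for i j
      using that g coordinate_in_mixed_polynomials(2)[of i k "\<tau> (inv\<^bsub>G\<^esub> g) j" N d] \<tau>_less
      by (simp add: act_apply)
    ultimately show ?thesis
      unfolding D_def mixed_polynomials_def
      by (intro real_algebra_generated.add real_algebra_generated_sum real_algebra_generated_square_diff) auto
  qed
  then have "F \<in> mixed_polynomials d N k"
    unfolding F_def mixed_polynomials_def by (rule real_algebra_generated_prod)
  moreover have "F (act g w) = F w" if "g \<in> carrier G" for g w
  proof -
    have "F (act g w) = (\<Prod>h\<in>carrier G. D (act (h \<otimes>\<^bsub>G\<^esub> g) w))"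
      unfolding F_def using that by (simp add: act_mult)
    also have "\<dots> = F w"
      unfolding F_def using that
      by (intro prod.reindex_bij_witness[where i = "\<lambda>h. h \<otimes>\<^bsub>G\<^esub> inv\<^bsub>G\<^esub> g" and j = "\<lambda>h. h \<otimes>\<^bsub>G\<^esub> g"])
         (auto simp: m_assoc)
    finally show ?thesis .
  qed
  ultimately have "F \<in> invariant_polynomials G d N \<sigma> \<tau> k"
    by (simp add: invariant_polynomials_def)
  moreover have "F z = 0"
    unfolding F_def using fin act_one[OF points[OF z]] D_eq_0[OF z]
    by (intro prod_zero) (auto intro: bexI[of _ "\<one>\<^bsub>G\<^esub>"])
  moreover have "\<exists>g\<in>carrier G. z = act g w"
    if w: "w \<in> topspace (Euclidean_space d) \<times> matrices k N" and "F w = 0" for w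
  proof -
    obtain g where "g \<in> carrier G" "D (act g w) = 0"
      using \<open>F w = 0\<close> fin by (auto simp: F_def)
    with D_eq_0[OF act_mem[OF _ w]] show ?thesis
      by blast
  qed
  ultimately show ?thesis
    using that by blast
qed

end


section \<open>Topology of the Stiefel manifolds\<close>

lemma topspace_final_topology: "topspace (final_topology T f) = (\<Union>i. f i ` topspace (T i))"
proof
  show "topspace (final_topology T f) \<subseteq> (\<Union>i. f i ` topspace (T i))"
    using openin_topspace[of "final_topology T f"] unfolding openin_final_topology by blast
  have "{x \<in> topspace (T i). f i x \<in> (\<Union>i. f i ` topspace (T i))} = topspace (T i)" for i
    by blast
  then have "openin (final_topology T f) (\<Union>i. f i ` topspace (T i))"
    by (simp add: openin_final_topology)
  then show "(\<Union>i. f i ` topspace (T i)) \<subseteq> topspace (final_topology T f)"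
    by (rule openin_subset)
qed

lemma quotient_map_final_topology:
  "quotient_map S (final_topology (\<lambda>_::unit. S) (\<lambda>_. f)) f"
  by (auto simp: quotient_map_def topspace_final_topology openin_final_topology)

lemma continuous_map_into_final_topology: "continuous_map (T i) (final_topology T f) (f i)"
  by (auto simp: continuous_map_def topspace_final_topology openin_final_topology)

lemma stiefel_eq: "stiefel N k = top_of_set (stiefel_set N k)"
  by (simp add: stiefel_def euclidean_product_topology)

lemma stiefel_set_mono: "stiefel_set N k \<subseteq> stiefel_set N (Suc k)"
  by (auto simp: stiefel_set_def matrices_def)

lemma topspace_stiefel_inf: "topspace (stiefel_inf N) = (\<Union>k. stiefel_set N k)"
  by (simp add: stiefel_inf_def topspace_final_topology stiefel_def)

text \<open>With this, polynomials in finitely many matrix entries are continuous on the infinite Stiefel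
  manifold.\<close>

lemma continuous_map_stiefel_inf_euclidean: "continuous_map (stiefel_inf N) euclidean id"
proof -
  have "openin (stiefel N k) {x \<in> topspace (stiefel N k). x \<in> topspace (stiefel_inf N) \<inter> U}"
    if "open U" for U k
  proof -
    have "{x \<in> topspace (stiefel N k). x \<in> topspace (stiefel_inf N) \<inter> U} = stiefel_set N k \<inter> U"
      by (auto simp: topspace_stiefel_inf stiefel_def)
    then show ?thesis
      using that by (auto simp: stiefel_eq openin_open)
  qed
  moreover have "{x \<in> topspace (stiefel_inf N). x \<in> U} = topspace (stiefel_inf N) \<inter> U" for U
    by auto
  moreover have "topspace (stiefel_inf N) \<inter> U \<subseteq> (\<Union>i. id ` topspace (stiefel N i))" for U
    by (auto simp: topspace_stiefel_inf stiefel_def)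
  ultimately show ?thesis
    by (simp add: continuous_map_def stiefel_inf_def openin_final_topology)
qed

lemma compact_stiefel_set: "compact (stiefel_set N k)"
proof -
  let ?K = "PiE UNIV (\<lambda>_. {-1..1}) :: (nat \<times> nat \<Rightarrow> real) set"
  have coord: "continuous_on UNIV (\<lambda>A :: nat \<times> nat \<Rightarrow> real. A i)" for i
    by (rule continuous_on_product_coordinates)
  have "compactin (powertop_real UNIV) ?K"
    by (simp add: compactin_PiE)
  then have "compact ?K"
    by (simp add: euclidean_product_topology)
  moreover have "closed (stiefel_set N k)"
  proof -
    have "stiefel_set N k = {A. \<forall>i j. i \<ge> k \<or> j \<ge> N \<longrightarrow> A (i, j) = 0} \<inter>
        {A. \<forall>a b. a < N \<longrightarrow> b < N \<longrightarrow> (\<Sum>i<k. A (i, a) * A (i, b)) = (if a = b then 1 else 0)}"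
      by (auto simp: stiefel_set_def matrices_def)
    also have "closed \<dots>"
      by (intro closed_Int closed_Collect_all closed_Collect_imp closed_Collect_eq
          continuous_intros coord open_Collect_const)
    finally show ?thesis .
  qed
  moreover have "stiefel_set N k \<subseteq> ?K"
  proof
    fix A assume A: "A \<in> stiefel_set N k"
    have "A (i, j) \<in> {-1..1}" for i j
    proof (cases "i < k \<and> j < N")
      case True
      then have "(A (i, j))\<^sup>2 \<le> (\<Sum>i<k. A (i, j) * A (i, j))"
        by (intro order.trans[OF _ member_le_sum[of i]]) (auto simp: power2_eq_square)
      also have "\<dots> = 1"
        using A True by (auto simp: stiefel_set_def)
      finally show ?thesis
        using abs_square_le_1[of "A (i, j)"] by (auto simp: abs_le_iff)
    qed (use A in \<open>auto simp: stiefel_set_def matrices_def\<close>)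
    then show "A \<in> ?K"
      by auto
  qed
  ultimately show ?thesis
    using closed_Int_compact[of "stiefel_set N k" ?K] by (simp add: inf.absorb1)
qed


section \<open>The geometric quotients and the Borel construction\<close>

text \<open>The compact set \<open>Z\<close> will be the Zariski closure of \<open>X\<close>. It is there because \<open>X\<close> itself may be
  neither closed nor locally compact: the quotient maps are closed on account of \<open>Z\<close>.\<close>

locale borel_quotients = permutation_actions +
  fixes X Z :: "(nat \<Rightarrow> real) set" and m :: "nat \<Rightarrow> nat" and p :: "nat \<Rightarrow> nat \<Rightarrow> point \<Rightarrow> real"
  assumes X_Z: "X \<subseteq> Z" and Z: "compact Z" "Z \<subseteq> topspace (Euclidean_space d)"
    and X_stable: "\<lbrakk>g \<in> carrier G; x \<in> X\<rbrakk> \<Longrightarrow> coord_act G d \<sigma> g x \<in> X"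
    and generators: "compatible_generators G d N \<sigma> \<tau> m p"
begin

abbreviation quot :: "nat \<Rightarrow> point \<Rightarrow> nat \<Rightarrow> real" where
  "quot \<equiv> quot_map m p"

abbreviation orb :: "point \<Rightarrow> point set" where
  "orb \<equiv> orbit G act"

abbreviation Q :: "nat \<Rightarrow> (nat \<Rightarrow> real) topology" where
  "Q \<equiv> quot_space N X m p"

abbreviation incl :: "nat \<Rightarrow> (nat \<Rightarrow> real) \<Rightarrow> nat \<Rightarrow> real" where
  "incl \<equiv> quot_incl N X m p"

abbreviation Borel :: "point set topology" where
  "Borel \<equiv> borel_construction G d N \<sigma> \<tau> X"

abbreviation to_borel :: "nat \<Rightarrow> (nat \<Rightarrow> real) \<Rightarrow> point set" where
  "to_borel \<equiv> quot_to_borel G d N \<sigma> \<tau> X m p"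

abbreviation E_inf :: "point topology" where
  "E_inf \<equiv> prod_topology (subtopology (Euclidean_space d) X) (stiefel_inf N)"

lemma mixed_points: "Z \<times> stiefel_set N k \<subseteq> topspace (Euclidean_space d) \<times> matrices k N"
  using Z by (auto simp: stiefel_set_def)

lemma stage_mixed: "z \<in> X \<times> stiefel_set N k \<Longrightarrow> z \<in> topspace (Euclidean_space d) \<times> matrices k N"
  using mixed_points[of k] X_Z by blast

lemma points_mixed: "topspace (Euclidean_space d) \<times> matrices k N \<subseteq> points"
  by (auto simp: points_def matrices_def)

lemma topspace_E_inf: "topspace E_inf = X \<times> (\<Union>k. stiefel_set N k)"
  using X_Z Z by (auto simp: topspace_stiefel_inf)

lemma E_inf_points: "topspace E_inf \<subseteq> points"
  using mixed_points points_mixed X_Z unfolding topspace_E_inf by blast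

lemma act_X:
  assumes "g \<in> carrier G" "fst z \<in> X"
  shows "fst (act g z) \<in> X"
  using X_stable[OF assms] by (simp add: diag_act_def case_prod_beta)

lemma generator_invariant: "i < m k \<Longrightarrow> p k i \<in> invariant_polynomials G d N \<sigma> \<tau> k"
  using generators real_algebra_generated.gen[of "p k i" "p k ` {..<m k}"]
  by (auto simp: compatible_generators_def)

lemma quot_act:
  assumes "g \<in> carrier G" "z \<in> points"
  shows "quot k (act g z) = quot k z"
  using invariant_polynomial_act[OF generator_invariant assms] by (auto simp: quot_map_def)

lemma quot_eq_if_orbit_eq:
  assumes "z \<in> points" "w \<in> points" "orb z = orb w"
  shows "quot k z = quot k w"
proof -
  obtain g where "g \<in> carrier G" "w = act g z"
    using assms orbit_eq_iff by blast
  with quot_act[OF _ assms(1)] show ?thesis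
    by simp
qed

text \<open>The generators separate orbits because every invariant polynomial is a polynomial in them.\<close>

lemma orbit_eq_if_quot_eq:
  assumes z: "z \<in> topspace (Euclidean_space d) \<times> matrices k N"
    and w: "w \<in> topspace (Euclidean_space d) \<times> matrices k N" and eq: "quot k z = quot k w"
  obtains g where "g \<in> carrier G" "z = act g w"
proof -
  obtain F where F: "F \<in> invariant_polynomials G d N \<sigma> \<tau> k" "F z = 0"
    "\<And>w. \<lbrakk>w \<in> topspace (Euclidean_space d) \<times> matrices k N; F w = 0\<rbrakk> \<Longrightarrow> \<exists>g\<in>carrier G. z = act g w"
    using orbit_separating_polynomial[OF z] by blast
  have "p k i z = p k i w" if "i < m k" for i
    using fun_cong[OF eq, of i] that by (simp add: quot_map_def)
  moreover have "F \<in> real_algebra_generated (p k ` {..<m k})"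
    using F(1) generators by (simp add: compatible_generators_def)
  ultimately have "F z = F w"
    by (intro real_algebra_generated_eq_at[of F "p k ` {..<m k}"]) auto
  with F w that show ?thesis
    by auto
qed

lemma quot_Suc:
  assumes "z \<in> topspace (Euclidean_space d) \<times> matrices k N"
  shows "quot (Suc k) z = quot k z"
proof
  fix i
  have "m k \<le> m (Suc k)" "i < m k \<Longrightarrow> p (Suc k) i = p k i"
    "\<lbrakk>m k \<le> i; i < m (Suc k)\<rbrakk> \<Longrightarrow> p (Suc k) i z = 0"
    using generators assms by (auto simp: compatible_generators_def)
  then show "quot (Suc k) z i = quot k z i"
    by (auto simp: quot_map_def)
qed

lemma continuous_quot: "continuous_on UNIV (quot k)"
proof (rule continuous_on_coordinatewise_then_product)
  fix i
  have "continuous_on UNIV (p k i)" if "i < m k"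
    using generator_invariant[OF that] mixed_polynomial_continuous by (auto simp: invariant_polynomials_def)
  then show "continuous_on UNIV (\<lambda>z. quot k z i)"
    by (cases "i < m k") (auto simp: quot_map_def)
qed

lemma quot_space_eq: "Q k = top_of_set (quot k ` (X \<times> stiefel_set N k))"
proof -
  have "quot k ` S \<subseteq> topspace (Euclidean_space (m k))" for S
    by (auto simp: quot_map_def topspace_Euclidean_space)
  then show ?thesis
    by (simp add: quot_space_def Euclidean_space_def topspace_Euclidean_space subtopology_subtopology
        euclidean_product_topology Int_absorb1)
qed

lemma topspace_quot_space: "topspace (Q k) = quot k ` (X \<times> stiefel_set N k)"
  by (simp add: quot_space_eq)

lemma quot_saturated:
  assumes z: "z \<in> Z \<times> stiefel_set N k" and w: "w \<in> X \<times> stiefel_set N k" and eq: "quot k z = quot k w"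
  shows "z \<in> X \<times> stiefel_set N k"
proof -
  obtain g where "g \<in> carrier G" "z = act g w"
    using orbit_eq_if_quot_eq[OF _ _ eq] z w X_Z mixed_points by blast
  with w act_X[of g w] act_stiefel_set[of g w k] show ?thesis
    by (auto simp: mem_Times_iff)
qed

text \<open>On the product of the compact set \<open>Z\<close> with the Stiefel manifold the generators form a closed
  map. It stays closed when restricted to the part over \<open>X\<close>, which is a union of fibres.\<close>

lemma quotient_map_quot:
  "quotient_map (top_of_set (X \<times> stiefel_set N k)) (Q k) (quot k)"
proof (rule continuous_closed_imp_quotient_map)
  let ?C = "Z \<times> stiefel_set N k"
  have cont: "continuous_on S (quot k)" for S
    using continuous_quot continuous_on_subset by blast
  have "compact ?C"
    using Z(1) compact_stiefel_set by (rule compact_Times)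
  have "closed_map (top_of_set ?C) euclidean (quot k)"
    unfolding closed_map_def
  proof (intro allI impI)
    fix U assume "closedin (top_of_set ?C) U"
    then have "compact U"
      using \<open>compact ?C\<close> closedin_compact by blast
    then show "closedin euclidean (quot k ` U)"
      using cont compact_continuous_image compact_imp_closed by auto
  qed
  moreover have "{z \<in> topspace (top_of_set ?C). quot k z \<in> quot k ` (X \<times> stiefel_set N k)} =
      X \<times> stiefel_set N k"
    using X_Z quot_saturated by auto
  ultimately have "closed_map (subtopology (top_of_set ?C) (X \<times> stiefel_set N k)) (Q k) (quot k)"
    unfolding quot_space_eq by (rule closed_map_restriction)
  then show "closed_map (top_of_set (X \<times> stiefel_set N k)) (Q k) (quot k)"
    using X_Z by (simp add: subtopology_subtopology Sigma_mono inf.absorb2)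
  show "continuous_map (top_of_set (X \<times> stiefel_set N k)) (Q k) (quot k)"
    unfolding quot_space_eq using cont by (auto simp: continuous_map_in_subtopology)
qed (simp add: topspace_quot_space)

lemma quot_incl_quot:
  assumes "z \<in> X \<times> stiefel_set N k"
  shows "incl k (quot k z) = quot (Suc k) z"
  unfolding quot_incl_def
proof (rule descend_eq[OF assms])
  show "quot (Suc k) w = quot (Suc k) z" if "w \<in> X \<times> stiefel_set N k" "quot k w = quot k z" for w
    using that assms quot_Suc[OF stage_mixed] by metis
qed

text \<open>The additional generators vanish on the smaller quotient, so it is literally a subset of the
  larger one.\<close>

lemma quot_incl_id:
  assumes "y \<in> topspace (Q k)"
  shows "incl k y = y"
proof -
  obtain z where "y = quot k z" "z \<in> X \<times> stiefel_set N k"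
    using assms by (auto simp only: topspace_quot_space)
  with quot_incl_quot[of z k] quot_Suc[OF stage_mixed, of z k] show ?thesis
    by simp
qed

lemma topspace_quot_space_Suc:
  "topspace (Q k) \<subseteq> topspace (Q (Suc k))"
proof
  fix y assume "y \<in> topspace (Q k)"
  then obtain z where "y = quot k z" "z \<in> X \<times> stiefel_set N k"
    by (auto simp only: topspace_quot_space)
  moreover from this have "quot (Suc k) z = quot k z"
    using quot_Suc[OF stage_mixed] by blast
  moreover have "z \<in> X \<times> stiefel_set N (Suc k)"
    using calculation(2) stiefel_set_mono[of N k] by blast
  ultimately show "y \<in> topspace (Q (Suc k))"
    unfolding topspace_quot_space by (intro image_eqI[of _ _ z]) simp_all
qed

lemma quot_space_subtopology:
  "Q k = subtopology (Q (Suc k)) (topspace (Q k))"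
  using topspace_quot_space_Suc[of k]
  by (simp add: quot_space_eq subtopology_subtopology inf.absorb2)

text \<open>The smaller quotient is cut out of the larger one by the compact image of \<open>Z\<close> times the smaller
  Stiefel manifold.\<close>

lemma closedin_quot_space_Suc:
  "closedin (Q (Suc k)) (topspace (Q k))"
proof -
  have "compact (Z \<times> stiefel_set N k)"
    using Z(1) compact_stiefel_set by (rule compact_Times)
  then have closed: "closed (quot (Suc k) ` (Z \<times> stiefel_set N k))"
    using continuous_quot continuous_on_subset compact_continuous_image compact_imp_closed by blast
  have "topspace (Q k) =
      topspace (Q (Suc k)) \<inter> quot (Suc k) ` (Z \<times> stiefel_set N k)"
  proof (intro equalityI subsetI)
    fix y assume y: "y \<in> topspace (Q k)"
    then obtain z where z: "y = quot k z" "z \<in> X \<times> stiefel_set N k"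
      by (auto simp only: topspace_quot_space)
    then have "quot (Suc k) z = y" "z \<in> Z \<times> stiefel_set N k"
      using quot_Suc[OF stage_mixed] X_Z by (simp, blast)
    then show "y \<in> topspace (Q (Suc k)) \<inter> quot (Suc k) ` (Z \<times> stiefel_set N k)"
      using y topspace_quot_space_Suc by blast
  next
    fix y assume "y \<in> topspace (Q (Suc k)) \<inter> quot (Suc k) ` (Z \<times> stiefel_set N k)"
    then obtain z w where w: "y = quot (Suc k) w" "w \<in> X \<times> stiefel_set N (Suc k)"
      and z: "y = quot (Suc k) z" "z \<in> Z \<times> stiefel_set N k"
      unfolding topspace_quot_space by blast
    then have "z \<in> Z \<times> stiefel_set N (Suc k)"
      using stiefel_set_mono by blast
    then have "z \<in> X \<times> stiefel_set N (Suc k)"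
      using quot_saturated[of z "Suc k" w] z(1) w by simp
    then have "z \<in> X \<times> stiefel_set N k"
      using z(2) by (simp add: mem_Times_iff)
    moreover have "quot k z = y"
      using z quot_Suc[of z k] mixed_points[of k] by auto
    ultimately show "y \<in> topspace (Q k)"
      by (auto simp only: topspace_quot_space)
  qed
  also have "closedin (Q (Suc k)) \<dots>"
    unfolding quot_space_eq using closed by (simp add: closedin_closed_Int)
  finally show ?thesis .
qed

lemma embedding_map_quot_incl:
  "embedding_map (Q k) (Q (Suc k)) (incl k)"
proof -
  have "incl k ` topspace (Q k) = topspace (Q k)"
    using quot_incl_id by force
  moreover have "homeomorphic_map (Q k) (Q k) (incl k)"
    by (rule homeomorphic_map_eq[of _ _ id]) (simp_all add: quot_incl_id)
  ultimately show ?thesis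
    by (simp add: embedding_map_def flip: quot_space_subtopology)
qed

lemma closed_map_quot_incl:
  "closed_map (Q k) (Q (Suc k)) (incl k)"
  unfolding closed_map_def
proof (intro allI impI)
  fix U assume U: "closedin (Q k) U"
  then have "incl k ` U = U"
    using quot_incl_id closedin_subset by force
  moreover have "closedin (Q (Suc k)) U"
    using U closedin_quot_space_Suc by (metis closedin_trans_full quot_space_subtopology)
  ultimately show "closedin (Q (Suc k)) (incl k ` U)"
    by simp
qed

lemma quot_to_borel_quot:
  assumes "z \<in> X \<times> stiefel_set N k"
  shows "to_borel k (quot k z) = orb z"
  unfolding quot_to_borel_def
proof (rule descend_eq[OF assms])
  fix w assume w: "w \<in> X \<times> stiefel_set N k" "quot k w = quot k z"
  have mixed: "w \<in> topspace (Euclidean_space d) \<times> matrices k N" "z \<in> topspace (Euclidean_space d) \<times> matrices k N"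
    using assms w(1) stage_mixed by blast+
  then obtain g where "g \<in> carrier G" "w = act g z"
    using orbit_eq_if_quot_eq w(2) by blast
  moreover have "w \<in> points" "z \<in> points"
    using mixed points_mixed by blast+
  ultimately show "orb w = orb z"
    using orbit_eq_iff by blast
qed

lemma quotient_map_orbit: "quotient_map E_inf Borel orb"
  unfolding borel_construction_def by (rule quotient_map_final_topology)

lemma topspace_borel: "topspace Borel = orb ` (X \<times> (\<Union>k. stiefel_set N k))"
  using quotient_imp_surjective_map[OF quotient_map_orbit, symmetric] by (simp only: topspace_E_inf)

lemma subtopology_Euclidean_space_X: "subtopology (Euclidean_space d) X = top_of_set X"
  using X_Z Z
  by (simp add: Euclidean_space_def topspace_Euclidean_space subtopology_subtopology
      euclidean_product_topology inf.absorb2 subset_trans)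

lemma continuous_map_quot_to_borel:
  "continuous_map (Q k) Borel (to_borel k)"
proof -
  have "continuous_map (stiefel N k) (stiefel_inf N) id"
    using continuous_map_into_final_topology[of "stiefel N" k "\<lambda>_. id"] by (simp add: stiefel_inf_def)
  then have "continuous_map (prod_topology (top_of_set X) (stiefel N k)) E_inf (\<lambda>(x, A). (id x, id A))"
    unfolding subtopology_Euclidean_space_X by (intro continuous_map_prod_top[THEN iffD2]) (simp add: id_def)
  moreover have "prod_topology (top_of_set X) (stiefel N k) = top_of_set (X \<times> stiefel_set N k)"
    by (simp add: stiefel_eq flip: subtopology_Times)
  ultimately have "continuous_map (top_of_set (X \<times> stiefel_set N k)) E_inf id"
    by (simp add: id_def)
  then have "continuous_map (top_of_set (X \<times> stiefel_set N k)) Borel (orb \<circ> id)"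
    using quotient_map_orbit continuous_map_compose quotient_imp_continuous_map by blast
  then have "continuous_map (top_of_set (X \<times> stiefel_set N k)) Borel
      (to_borel k \<circ> quot k)"
    by (rule continuous_map_eq) (simp add: quot_to_borel_quot)
  then show ?thesis
    using continuous_compose_quotient_map_eq[OF quotient_map_quot] by blast
qed

text \<open>The generators for \<open>k\<close> are invariant on the whole Borel construction, where they define a
  continuous map that inverts \<open>to_borel k\<close> on its image. Hence a continuous map into that image lifts
  to a continuous map into the \<open>k\<close>-th quotient.\<close>

lemma borel_left_inverse:
  obtains r where "continuous_map Borel euclidean r"
    "\<And>z. z \<in> topspace E_inf \<Longrightarrow> r (orb z) = quot k z"
proof
  let ?r = "descend (topspace E_inf) orb (quot k)"
  show r: "?r (orb z) = quot k z" if "z \<in> topspace E_inf" for z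
    using that E_inf_points by (intro descend_eq) (auto intro: quot_eq_if_orbit_eq)
  have "continuous_map (stiefel_inf N) euclidean id"
    by (rule continuous_map_stiefel_inf_euclidean)
  then have "continuous_map E_inf (prod_topology euclidean euclidean) (\<lambda>(x, A). (id x, id A))"
    unfolding subtopology_Euclidean_space_X by (intro continuous_map_prod_top[THEN iffD2]) (simp add: id_def)
  then have "continuous_map E_inf euclidean id"
    by (simp add: id_def)
  then have "continuous_map E_inf euclidean (quot k \<circ> id)"
    by (rule continuous_map_compose) (simp add: continuous_quot)
  then have "continuous_map E_inf euclidean (?r \<circ> orb)"
    by (rule continuous_map_eq) (simp only: r o_apply id_apply)
  then show "continuous_map Borel euclidean ?r"
    using continuous_compose_quotient_map_eq[OF quotient_map_orbit] by blast
qed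

text \<open>If a compact set met the complement of every stage, the matrices occurring in the orbits
  \<open>y k\<close> of such points would meet every stage in a finite set. So removing the orbits \<open>y i\<close> with
  \<open>i \<ge> k\<close> leaves open sets that increase to the whole space, and one of them would contain the
  compact set.\<close>

lemma compactin_borel_stage:
  assumes K: "compactin Borel K"
  obtains k where "K \<subseteq> orb ` (X \<times> stiefel_set N k)"
proof (rule ccontr)
  assume "\<not> thesis"
  then have "\<exists>y. y \<in> K \<and> y \<notin> orb ` (X \<times> stiefel_set N k)" for k
    using that by blast
  then obtain y where y: "\<And>k. y k \<in> K" "\<And>k. y k \<notin> orb ` (X \<times> stiefel_set N k)"
    by metis
  have orb_stage: "y i \<noteq> orb z" if "z \<in> X \<times> stiefel_set N k" "k \<le> i" for z k i
  proof -
    have "stiefel_set N k \<subseteq> stiefel_set N i"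
      using lift_Suc_mono_le[of "stiefel_set N" k i, OF stiefel_set_mono that(2)] .
    with that y(2)[of i] show ?thesis
      by blast
  qed
  have y_orb: "\<exists>z\<in>topspace E_inf. y i = orb z" for i
    using y(1)[of i] compactin_subset_topspace[OF K] unfolding topspace_borel topspace_E_inf by blast
  define W where "W j = topspace (stiefel_inf N) - (\<Union>i\<in>{j..}. snd ` y i)" for j
  have disjoint: "snd ` y i \<inter> stiefel_set N k = {}" if "k \<le> i" for i k
  proof -
    have False if u: "u \<in> y i" "snd u \<in> stiefel_set N k" for u
    proof -
      obtain z where z: "z \<in> topspace E_inf" "y i = orb z"
        using y_orb by blast
      then obtain g where g: "g \<in> carrier G" "u = act g z"
        using u by (auto simp: orbit_def)
      then have "fst u \<in> X"
        using act_X z(1) by (auto simp: topspace_E_inf mem_Times_iff)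
      then have uX: "u \<in> X \<times> stiefel_set N k"
        using u(2) by (auto simp: mem_Times_iff)
      then have "u \<in> points" "z \<in> points"
        using mixed_points points_mixed X_Z z(1) E_inf_points by blast+
      then have "orb z = orb u"
        using g orbit_eq_iff by blast
      with orb_stage[OF uX \<open>k \<le> i\<close>] z show False
        by simp
    qed
    then show ?thesis
      by auto
  qed
  have finite_y: "finite (snd ` y i)" for i
    using y_orb[of i] fin by (auto simp: orbit_def)
  have "openin (stiefel_inf N) (W j)" for j
    unfolding stiefel_inf_def openin_final_topology
  proof (intro conjI allI)
    fix k
    have *: "A \<in> (\<Union>i\<in>{j..}. snd ` y i) \<longleftrightarrow> A \<in> (\<Union>i\<in>{j..<k}. snd ` y i)"
      if A: "A \<in> stiefel_set N k" for A
    proof -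
      have "i < k" if "A \<in> snd ` y i" for i
        using disjoint[of k i] that A by (cases "i < k") auto
      then show ?thesis
        by (simp only: UN_iff Bex_def atLeast_iff atLeastLessThan_iff) metis
    qed
    have "{A \<in> topspace (stiefel N k). id A \<in> W j} = stiefel_set N k - (\<Union>i\<in>{j..}. snd ` y i)"
      by (auto simp: W_def topspace_stiefel_inf stiefel_def)
    also have "\<dots> = stiefel_set N k - (\<Union>i\<in>{j..<k}. snd ` y i)"
      by (rule Set.set_eqI) (metis * Diff_iff)
    finally have "{A \<in> topspace (stiefel N k). id A \<in> W j} = stiefel_set N k - (\<Union>i\<in>{j..<k}. snd ` y i)" .
    moreover have "closed (\<Union>i\<in>{j..<k}. snd ` y i)"
      using finite_y by (intro finite_imp_closed) auto
    ultimately show "openin (stiefel N k) {A \<in> topspace (stiefel N k). id A \<in> W j}"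
      by (simp only: stiefel_eq openin_open_Int Diff_eq open_Compl)
  qed (auto simp: W_def topspace_stiefel_inf stiefel_def)
  then have open_W: "openin E_inf (X \<times> W j)" for j
    by (simp add: openin_prod_Times_iff subtopology_Euclidean_space_X)
  define U where "U j = orb ` (X \<times> W j)" for j
  have W_sub: "X \<times> W j \<subseteq> topspace E_inf" for j
    using open_W by (rule openin_subset)
  have preimage: "{z \<in> topspace E_inf. orb z \<in> U j} = X \<times> W j" for j
  proof (intro equalityI subsetI)
    fix z assume "z \<in> {z \<in> topspace E_inf. orb z \<in> U j}"
    then obtain w where z: "z \<in> topspace E_inf" and w: "w \<in> X \<times> W j" "orb z = orb w"
      unfolding U_def by blast
    then have "w \<in> points" "z \<in> points"
      using W_sub E_inf_points by blast+
    then obtain g where g: "g \<in> carrier G" "w = act g z"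
      using orbit_eq_iff w(2) by blast
    have "snd z \<notin> snd ` y i" if "j \<le> i" for i
    proof
      assume "snd z \<in> snd ` y i"
      then obtain u where u: "u \<in> y i" "snd z = snd u"
        by blast
      then have "act g u \<in> y i"
        using g y_orb[of i] act_mem_orbit by blast
      moreover have "snd (act g u) = snd w"
        unfolding g(2) act_apply[OF g(1)] u(2) snd_conv by (rule refl)
      ultimately have "snd w \<in> snd ` y i"
        by (metis imageI)
      then show False
        using w(1) that by (auto simp: W_def mem_Times_iff)
    qed
    then show "z \<in> X \<times> W j"
      using z by (auto simp: topspace_E_inf W_def topspace_stiefel_inf mem_Times_iff)
  next
    fix z assume "z \<in> X \<times> W j"
    then show "z \<in> {z \<in> topspace E_inf. orb z \<in> U j}"
      using W_sub unfolding U_def by blast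
  qed
  have U_sub: "U j \<subseteq> topspace Borel" for j
    using W_sub[of j] quotient_imp_surjective_map[OF quotient_map_orbit] unfolding U_def by blast
  have "openin Borel (U j)" for j
  proof -
    have "openin E_inf {z \<in> topspace E_inf. orb z \<in> U j} =
        openin Borel (U j)"
      using quotient_map_orbit U_sub unfolding quotient_map_def by blast
    then show ?thesis
      by (simp only: preimage open_W)
  qed
  moreover have "K \<subseteq> \<Union>(range U)"
  proof
    fix v assume "v \<in> K"
    then have "v \<in> orb ` (X \<times> (\<Union>k. stiefel_set N k))"
      using compactin_subset_topspace[OF K] unfolding topspace_borel by blast
    then obtain x A k where "v = orb (x, A)" "x \<in> X" "A \<in> stiefel_set N k"
      by blast
    moreover from this have "A \<in> W k"
      using disjoint[of k] unfolding W_def topspace_stiefel_inf by blast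
    ultimately show "v \<in> \<Union>(range U)"
      unfolding U_def by blast
  qed
  ultimately obtain \<F> where "finite \<F>" "\<F> \<subseteq> range U" "K \<subseteq> \<Union>\<F>"
    using compactinD[OF K, of "range U"] by auto
  then obtain J where J: "finite J" "K \<subseteq> \<Union>(U ` J)"
    by (metis finite_subset_image)
  then obtain n where "\<forall>j\<in>J. j \<le> n"
    using finite_nat_set_iff_bounded_le by blast
  then have "W j \<subseteq> W n" if "j \<in> J" for j
    using that unfolding W_def by (intro Diff_mono UN_mono) auto
  then have "K \<subseteq> U n"
    using J(2) unfolding U_def by blast
  then obtain w where w: "w \<in> X \<times> W n" "y n = orb w"
    using y(1)[of n] unfolding U_def by blast
  then have "w \<in> y n"
    using W_sub E_inf_points mem_orbit_self by blast
  with w(1) show False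
    by (auto simp: W_def mem_Times_iff)
qed

text \<open>A singular simplex has compact image, so it lies over one stage, and the continuous inverse of
  that stage's map to the Borel construction lifts it.\<close>

lemma singular_union_quot_spaces:
  "singular_union Q incl Borel to_borel"
proof
  fix k
  show "continuous_map (Q k) (Q (Suc k)) (incl k)"
    using embedding_map_quot_incl homeomorphic_imp_continuous_map continuous_map_in_subtopology
    unfolding embedding_map_def by blast
  show "continuous_map (Q k) Borel (to_borel k)"
    by (rule continuous_map_quot_to_borel)
  have stage_points: "X \<times> stiefel_set N k \<subseteq> points" for k
    using mixed_points points_mixed X_Z by blast
  show "inj_on (to_borel k) (topspace (Q k))"
  proof (rule inj_onI)
    fix u v assume "u \<in> topspace (Q k)" "v \<in> topspace (Q k)"
      and eq: "to_borel k u = to_borel k v"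
    then obtain z w where z: "u = quot k z" "z \<in> X \<times> stiefel_set N k"
      and w: "v = quot k w" "w \<in> X \<times> stiefel_set N k"
      by (auto simp only: topspace_quot_space)
    then have "orb z = orb w"
      using eq quot_to_borel_quot by simp
    then show "u = v"
      using z w quot_eq_if_orbit_eq[of z w k] stage_points by blast
  qed
  fix u assume "u \<in> topspace (Q k)"
  then obtain z where z: "u = quot k z" "z \<in> X \<times> stiefel_set N k"
    by (auto simp only: topspace_quot_space)
  moreover have "z \<in> X \<times> stiefel_set N (Suc k)"
    using z(2) stiefel_set_mono by blast
  ultimately show "to_borel (Suc k) (incl k u) =
      to_borel k u"
    by (simp only: quot_incl_quot quot_to_borel_quot)
next
  fix n s assume s: "singular_simplex n Borel s"
  let ?\<Delta> = "subtopology (powertop_real UNIV) (standard_simplex n)"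
  have cont_s: "continuous_map ?\<Delta> Borel s"
    and ext_s: "s \<in> extensional (standard_simplex n)"
    using s by (auto simp: singular_simplex_def)
  have "compactin ?\<Delta> (standard_simplex n)"
    by (simp add: compactin_subtopology compactin_standard_simplex)
  from image_compactin[OF this cont_s] obtain k where k: "s ` standard_simplex n \<subseteq> orb ` (X \<times> stiefel_set N k)"
    using compactin_borel_stage by blast
  obtain r where r: "continuous_map Borel euclidean r"
    "\<And>z. z \<in> topspace E_inf \<Longrightarrow> r (orb z) = quot k z"
    by (rule borel_left_inverse[where k = k]) blast
  have r_s: "r (s x) \<in> topspace (Q k) \<and>
      to_borel k (r (s x)) = s x"
    if "x \<in> standard_simplex n" for x
  proof -
    have "s x \<in> orb ` (X \<times> stiefel_set N k)"
      using k imageI[OF that] by (rule subsetD)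
    then obtain z where "s x = orb z" "z \<in> X \<times> stiefel_set N k"
      by (rule imageE)
    moreover from this have "r (orb z) = quot k z"
      by (intro r(2)) (auto simp only: topspace_E_inf)
    ultimately show ?thesis
      by (simp add: quot_to_borel_quot topspace_quot_space)
  qed
  define t where "t = restrict (r \<circ> s) (standard_simplex n)"
  have "continuous_map ?\<Delta> euclidean (r \<circ> s)"
    using cont_s r(1) by (rule continuous_map_compose)
  then have "continuous_map ?\<Delta> (Q k) (r \<circ> s)"
    using r_s topspace_quot_space unfolding quot_space_eq by (auto simp: continuous_map_in_subtopology)
  then have "continuous_map ?\<Delta> (Q k) t"
    by (rule continuous_map_eq) (simp add: t_def)
  then have "singular_simplex n (Q k) t"
    by (simp add: singular_simplex_def t_def)
  moreover have "s = simplex_map n (to_borel k) t"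
    using ext_s r_s by (auto simp: simplex_map_def t_def fun_eq_iff restrict_def extensional_def)
  ultimately show "\<exists>k t. singular_simplex n (Q k) t \<and>
      s = simplex_map n (to_borel k) t"
    by blast
qed

end

section \<open>The cohomology of the Borel construction of an AS-set\<close>

lemma AS_sets_subset_proj_space: "A \<in> AS_sets d \<Longrightarrow> A \<subseteq> proj_space d"
  by (induction rule: AS_sets.induct) (auto simp: arc_symmetric_def proj_semialgebraic_def)

lemma subset_proj_zariski_closure:
  assumes "A \<subseteq> proj_space d"
  shows "A \<subseteq> proj_zariski_closure d A"
proof
  fix a assume "a \<in> A"
  with assms obtain v where "a = proj_point v" "v \<in> hom_coords d"
    by (auto simp: proj_space_def)
  with \<open>a \<in> A\<close> show "a \<in> proj_zariski_closure d A"
    unfolding proj_zariski_closure_def by blast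
qed

text \<open>Equivariance of the realization holds on the Zariski closure of \<open>Y\<close>, which contains the
  \<open>G\<close>-stable set \<open>Y\<close>.\<close>

lemma affine_realization_stable:
  assumes "G_AS_set G e \<alpha> Y" "affine_realization G e \<alpha> Y d \<sigma> X \<phi>" "g \<in> carrier G" "x \<in> X"
  shows "coord_act G d \<sigma> g x \<in> X"
proof -
  obtain y where y: "y \<in> Y" "x = \<phi> y"
    using assms by (auto simp: affine_realization_def)
  have "Y \<subseteq> proj_zariski_closure e Y"
    using assms(1) by (simp add: G_AS_set_def AS_sets_subset_proj_space subset_proj_zariski_closure)
  then have "coord_act G d \<sigma> g x = \<phi> (\<alpha> g y)"
    using assms y by (auto simp: affine_realization_def)
  moreover have "\<alpha> g y \<in> Y"
    using assms(1,3) y by (auto simp: G_AS_set_def)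
  ultimately show ?thesis
    using assms(2) by (auto simp: affine_realization_def)
qed

theorem corollary4p6:
  fixes G :: "('g, 'b) monoid_scheme" and N e d :: nat
    and \<alpha> :: "'g \<Rightarrow> (nat \<Rightarrow> real) set \<Rightarrow> (nat \<Rightarrow> real) set"
    and Y :: "(nat \<Rightarrow> real) set set" and X :: "(nat \<Rightarrow> real) set"
    and \<phi> :: "(nat \<Rightarrow> real) set \<Rightarrow> nat \<Rightarrow> real"
    and \<sigma> \<tau> :: "'g \<Rightarrow> nat \<Rightarrow> nat"
    and m :: "nat \<Rightarrow> nat" and p :: "nat \<Rightarrow> nat \<Rightarrow> point \<Rightarrow> real"
  assumes "group G" and "finite (carrier G)" and "N = order G"
    and "G_AS_set G e \<alpha> Y"
    and "affine_realization G e \<alpha> Y d \<sigma> X \<phi>"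
    and "faithful_action G {..<N} \<tau>"
    and "compatible_generators G d N \<sigma> \<tau> m p"
  shows
    "(\<forall>k. \<forall>z \<in> X \<times> stiefel_set N k.
        quot_incl N X m p k (quot_map m p k z) = quot_map m p (Suc k) z \<and>
        quot_to_borel G d N \<sigma> \<tau> X m p k (quot_map m p k z) = orbit G (diag_act G d N \<sigma> \<tau>) z) \<and>
     (\<forall>k. embedding_map (quot_space N X m p k) (quot_space N X m p (Suc k)) (quot_incl N X m p k) \<and>
        closed_map (quot_space N X m p k) (quot_space N X m p (Suc k)) (quot_incl N X m p k) \<and>
        continuous_map (quot_space N X m p k) (borel_construction G d N \<sigma> \<tau> X)
          (quot_to_borel G d N \<sigma> \<tau> X m p k)) \<and>
     (\<forall>n k. cohomology_map n (quot_space N X m p k) (quot_incl N X m p k)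
        \<in> hom (cohomology_group n (quot_space N X m p (Suc k)))
              (cohomology_group n (quot_space N X m p k))) \<and>
     (\<forall>n. (\<lambda>a. \<lambda>k. cohomology_map n (quot_space N X m p k) (quot_to_borel G d N \<sigma> \<tau> X m p k) a)
        \<in> iso (cohomology_group n (borel_construction G d N \<sigma> \<tau> X))
              (inverse_limit_group (\<lambda>k. cohomology_group n (quot_space N X m p k))
                 (\<lambda>k. cohomology_map n (quot_space N X m p k) (quot_incl N X m p k))))"
proof -
  have "borel_quotients G d N \<sigma> \<tau> X (affine_zariski_closure d X) m p"
  proof (intro borel_quotients.intro permutation_actions.intro borel_quotients_axioms.intro)
    show "Group.group G" "finite (carrier G)" "compatible_generators G d N \<sigma> \<tau> m p"
      using assms by auto
    show "group_action G {..<d} \<sigma>" "group_action G {..<N} \<tau>"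
      using assms by (auto simp: affine_realization_def faithful_action_def)
    show "X \<subseteq> affine_zariski_closure d X"
      using assms(5) by (auto simp: affine_realization_def affine_zariski_closure_def)
    show "compact (affine_zariski_closure d X)"
      using assms(5) by (auto simp: affine_realization_def Euclidean_space_def compactin_subtopology
          euclidean_product_topology)
    show "affine_zariski_closure d X \<subseteq> topspace (Euclidean_space d)"
      by (auto simp: affine_zariski_closure_def)
    show "coord_act G d \<sigma> g x \<in> X" if "g \<in> carrier G" "x \<in> X" for g x
      using affine_realization_stable[OF assms(4,5) that] .
  qed
  then interpret borel_quotients G d N \<sigma> \<tau> X "affine_zariski_closure d X" m p .
  interpret singular_union "\<lambda>k. quot_space N X m p k" "\<lambda>k. quot_incl N X m p k"
    "borel_construction G d N \<sigma> \<tau> X" "\<lambda>k. quot_to_borel G d N \<sigma> \<tau> X m p k"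
    by (rule singular_union_quot_spaces)
  show ?thesis
    using quot_incl_quot quot_to_borel_quot embedding_map_quot_incl closed_map_quot_incl
      continuous_map_quot_to_borel cohomology_map_hom[OF continuous_j] cohomology_iso_inverse_limit
    by (intro conjI allI ballI) blast+
qed

end
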